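(* Let $X=(X,d,\mu)$ be a metric measure space satisfying the standing assumptions of the context (in particular $\mu$ is doubling). Let $0<s<1$ and $1<t<\infty$. Assume that $X$ is complete and that $\mu$ is reverse doubling. Let $E\subset X$ be a closed set with $\overline{\operatorname{co\,dim}}_A(E)<st$, and let $u\colon X\to\mathbb R$ be a continuous function such that $u=0$ on $E$. Then there is a constant $C>0$, independent of $u$, such that \[ \int_{B\setminus E}\frac{|u(x)|^t}{d(x,E)^{st}}\,d\mu(x)\le C\int_{3B}\int_{3B}\frac{|u(x)-u(y)|^t}{d(x,y)^{st}\mu(B(x,d(x,y)))}\,d\mu(y)\,d\mu(x) \] whenever $B=B(w,r)$ with $w\in E$ and $0<r<\operatorname{diam}(E)$.
   Context: Standing assumptions: $X=(X,d,\mu)$ is a metric measure space with at least two points, where $\mu$ is a Borel measure supported on $X$ such that $\mu(\{x\})=0$ for all $x\in X$ and $0<\mu(B)<\infty$ for all open balls $B=B(x,r)=\{y\in X: d(x,y)<r\}$, $r>0$. Each ball has a fixed center and radius, and $\lambda B(x,r)=B(x,\lambda r)$. The measure $\mu$ is doubling: there is $c_D\ge1$ such that $\mu(B(x,2r))\le c_D\,\mu(B(x,r))$ for all $x\in X$, $r>0$. Here $d(x,E)$ is the distance from $x$ to $E$. Reverse doubling: there are constants $0<\kappa<1$ and $0<c_R<1$ such that $\mu(B(x,\kappa r))\le c_R\,\mu(B(x,r))$ for every $x\in X$ and $0<r<\operatorname{diam}(X)/2$. Upper Assouad codimension: for $E\subset X$ and $r>0$ let $E_r=\{x\in X:\operatorname{dist}(x,E)<r\}$.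 Then $\overline{\operatorname{co\,dim}}_A(E)$ is the infimum of all $Q\ge0$ for which there is $c>0$ such that \[ \frac{\mu(E_r\cap B(x,R))}{\mu(B(x,R))}\ge c\Bigl(\frac rR\Bigr)^Q \] for every $x\in E$ and all $0<r<R<\operatorname{diam}(E)$. If $E$ consists of one point, the restriction $R<\operatorname{diam}(E)$ is removed. *)

theory Defs
  imports "HOL-Analysis.Analysis"
begin

(* The metric space X is the whole type; its distance is dist. The measure is an
   ordinary Borel measure; that it is supported on X is part of ball_pos. *)
locale metric_measure_space =
  fixes M :: "'a::metric_space measure"
  assumes two_points: "\<exists>x y :: 'a. x \<noteq> y"
    and sets_borel: "sets M = sets borel"
    and point_null: "\<And>x. emeasure M {x} = 0"
    and ball_pos: "\<And>x r. 0 < r \<Longrightarrow> 0 < emeasure M (ball x r)"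
    and ball_finite: "\<And>x r. 0 < r \<Longrightarrow> emeasure M (ball x r) < \<infinity>"

definition doubling_measure :: "'a::metric_space measure \<Rightarrow> bool" where
  "doubling_measure M \<longleftrightarrow>
     (\<exists>cD::real. 1 \<le> cD \<and>
        (\<forall>x r. 0 < r \<longrightarrow> emeasure M (ball x (2 * r)) \<le> ennreal cD * emeasure M (ball x r)))"

(* The library's diameter is 0 on unbounded sets; here the diameter of an
   unbounded set has to be infinite. *)
definition ediam :: "'a::metric_space set \<Rightarrow> ennreal" where
  "ediam A = (SUP x\<in>A. SUP y\<in>A. ennreal (dist x y))"

definition reverse_doubling_measure :: "'a::metric_space measure \<Rightarrow> bool" where
  "reverse_doubling_measure M \<longleftrightarrow>
     (\<exists>\<kappa> cR::real. 0 < \<kappa> \<and> \<kappa> < 1 \<and> 0 < cR \<and> cR < 1 \<and>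
        (\<forall>x r. 0 < r \<and> ennreal r < ediam (UNIV :: 'a set) / 2 \<longrightarrow>
           emeasure M (ball x (\<kappa> * r)) \<le> ennreal cR * emeasure M (ball x r)))"

definition open_nbhd :: "'a::metric_space set \<Rightarrow> real \<Rightarrow> 'a set" where
  "open_nbhd E r = {x. infdist x E < r}"

(* The infimum is taken in the extended nonnegative reals, so that it is infinite
   if there is no admissible exponent Q. *)
definition upper_Assouad_codim :: "'a::metric_space measure \<Rightarrow> 'a set \<Rightarrow> ennreal" where
  "upper_Assouad_codim M E =
     Inf {ennreal Q | Q::real. 0 \<le> Q \<and>
       (\<exists>c::real. 0 < c \<and>
         (\<forall>x\<in>E. \<forall>r R::real.
            0 < r \<and> r < R \<and> (is_singleton E \<or> ennreal R < ediam E) \<longrightarrow>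
            c * (r / R) powr Q
              \<le> measure M (open_nbhd E r \<inter> ball x R) / measure M (ball x R)))}"

end

(* Write rho_j = lam^j r and let N_j be a rho_j-separated net of E. Starting from a net point z of
   level j, pass at random to a net point z' of level j + 1 within 2 rho_j, with probability
   proportional to the mass of the ball around z'. The codimension bound, with exponent Q < st, says
   that the children of z have total mass at least a multiple of lam^Q mu(B(z, rho_j)), so l steps
   increase densities with respect to mu at most by (C lam^-Q)^l. Telescoping |u|^t along such a
   chain costs a factor beta^l at step l, where beta = 2^(t-1), and since u is continuous and
   vanishes on E the remainder tends to zero, uniformly on the ball, which is compact because X is
   complete and mu is doubling. The increments at level j + l carry the weight rho_(j+l)^(st) of the
   fractional energy, so for small lam the total factor (beta C lam^(st-Q))^l is summable. Summing
   over all levels, the energies at the different scales add up to the double integral because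
   sum rho_j^(-st) over rho_j > d/5 is comparable to d^(-st). *)
theory Submission
  imports Defs
begin

section \<open>Weighted convexity of the t-th power\<close>

text \<open>The expression \<open>p powr (1 - t) * x powr t\<close> equals
  \<open>p * (x / p) powr t\<close>, the perspective of the convex function z^t. A perspective is
  convex and homogeneous of degree one, hence subadditive in the pair (p, x). The free weights allow
  a chain of arbitrarily many triangle inequalities without the constants multiplying up.\<close>

lemma powr_add_weighted:
  fixes x y p q t :: real
  assumes "1 \<le> t" "0 < p" "0 < q" "0 \<le> x" "0 \<le> y"
  shows "(p + q) powr (1 - t) * (x + y) powr t \<le> p powr (1 - t) * x powr t + q powr (1 - t) * y powr t"
proof -
  have zero: "(p + q) powr (1 - t) * z \<le> a powr (1 - t) * z" if "0 < a" "a \<le> p + q" "0 \<le> z" for a z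
    using that assms by (intro mult_right_mono powr_mono2') auto
  have persp: "a powr (1 - t) * b powr t = a * (b / a) powr t" if "0 < a" "0 \<le> b" for a b :: real
    using that by (simp add: powr_divide powr_diff)
  \<comment> \<open>Convexity is used on the open half-line, so a vanishing summand is treated
    apart; there it only matters that the exponent 1 - t is not positive.\<close>
  consider "x = 0" | "y = 0" | "0 < x" "0 < y" using assms by fastforce
  then show ?thesis
  proof cases
    case 1
    then show ?thesis using zero[of q "y powr t"] assms by simp
  next
    case 2
    then show ?thesis using zero[of p "x powr t"] assms by simp
  next
    case 3
    have "(p + q) * ((p / (p + q)) *\<^sub>R (x / p) + (q / (p + q)) *\<^sub>R (y / q)) powr t
        \<le> (p + q) * ((p / (p + q)) * (x / p) powr t + (q / (p + q)) * (y / q) powr t)"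
    proof (intro mult_left_mono)
      have "p / (p + q) + q / (p + q) = 1" "0 \<le> p / (p + q)" "0 \<le> q / (p + q)" "x / p \<in> {0<..}" "y / q \<in> {0<..}"
        using assms 3 by (auto simp: add_divide_distrib[symmetric])
      then show "((p / (p + q)) *\<^sub>R (x / p) + (q / (p + q)) *\<^sub>R (y / q)) powr t
          \<le> (p / (p + q)) * (x / p) powr t + (q / (p + q)) * (y / q) powr t"
        using powr_convex[OF assms(1)] unfolding convex_on_def by blast
    qed (use assms in auto)
    also have "(p / (p + q)) *\<^sub>R (x / p) + (q / (p + q)) *\<^sub>R (y / q) = (x + y) / (p + q)"
      using assms by (simp add: add_divide_distrib)
    also have "(p + q) * ((p / (p + q)) * (x / p) powr t + (q / (p + q)) * (y / q) powr t)
        = p * (x / p) powr t + q * (y / q) powr t"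
      using assms by (simp add: distrib_left)
    finally show ?thesis
      using assms by (simp add: persp)
  qed
qed

lemma ball_subset_ball_dist:
  fixes x y :: "'a::metric_space"
  assumes "dist x y + r \<le> s"
  shows "ball x r \<subseteq> ball y s"
proof
  fix z assume "z \<in> ball x r"
  then show "z \<in> ball y s" using assms dist_triangle[of y z x] by (simp add: dist_commute)
qed

section \<open>Ball masses, packing and compactness in doubling spaces\<close>

text \<open>Doubling is restated for the real-valued \<open>measure\<close>, so that quotients of
  ball masses obey real arithmetic; balls are finite, so this loses nothing. Completeness is carried
  by the sort.\<close>

locale doubling_space = metric_measure_space M for M :: "'a::complete_space measure" +
  fixes cD :: real
  assumes cD_ge_1: "1 \<le> cD"
    and doubling: "0 < r \<Longrightarrow> measure M (ball x (2 * r)) \<le> cD * measure M (ball x r)"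
begin

lemma sets_M [simp]: "sets M = sets borel"
  by (rule sets_borel)

lemma space_M [simp]: "space M = UNIV"
  using sets_eq_imp_space_eq[OF sets_borel] by simp

lemma borel_measurable_M_continuous:
  "continuous_on UNIV f \<Longrightarrow> f \<in> borel_measurable M"
  using borel_measurable_continuous_onI[of f] by (simp cong: measurable_cong_sets)

lemma emeasure_ball: "0 < r \<Longrightarrow> emeasure M (ball x r) = ennreal (measure M (ball x r))"
  using ball_finite[of r x] by (simp add: emeasure_eq_ennreal_measure)

lemma measure_ball_pos: "0 < r \<Longrightarrow> 0 < measure M (ball x r)"
  using ball_pos[of r x] emeasure_ball[of r x] by (simp add: ennreal_less_zero_iff)

lemma measure_mono_ball: "A \<subseteq> ball x r \<Longrightarrow> A \<in> sets borel \<Longrightarrow> 0 < r \<Longrightarrow> measure M A \<le> measure M (ball x r)"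
  using ball_finite[of r x] by (intro measure_mono_fmeasurable) (auto simp: fmeasurable_def)

lemma doubling_power: "0 < r \<Longrightarrow> measure M (ball x (2 ^ n * r)) \<le> cD ^ n * measure M (ball x r)"
proof (induction n)
  case (Suc n)
  have "measure M (ball x (2 * (2 ^ n * r))) \<le> cD * measure M (ball x (2 ^ n * r))"
    using Suc by (intro doubling) auto
  also have "\<dots> \<le> cD * (cD ^ n * measure M (ball x r))"
    using Suc cD_ge_1 by (intro mult_left_mono) auto
  finally show ?case by (simp add: mult_ac)
qed simp

lemma measure_ball_le:
  assumes "0 < r" "0 < R" "dist x y + R \<le> 2 ^ n * r"
  shows "measure M (ball x R) \<le> cD ^ n * measure M (ball y r)"
proof -
  have "ball x R \<subseteq> ball y (2 ^ n * r)"
    using assms(3) by (rule ball_subset_ball_dist)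
  then have "measure M (ball x R) \<le> measure M (ball y (2 ^ n * r))"
    using assms by (intro measure_mono_ball) auto
  also have "\<dots> \<le> cD ^ n * measure M (ball y r)"
    using assms by (intro doubling_power)
  finally show ?thesis .
qed

definition separated :: "real \<Rightarrow> 'a set \<Rightarrow> bool" where
  "separated \<rho> F \<longleftrightarrow> (\<forall>x\<in>F. \<forall>y\<in>F. x \<noteq> y \<longrightarrow> \<rho> \<le> dist x y)"

text \<open>A volume count: the balls of radius rho/2 around points of \<open>F\<close> are disjoint
  and lie in \<open>ball x (2 * R)\<close>. Each carries at least the fraction cD^-n of the mass of
  that ball, because R + 2R is at most 2^n (rho/2).\<close>

lemma card_separated_le:
  assumes F: "separated \<rho> F" "F \<subseteq> ball x R" and "0 < \<rho>" "\<rho> \<le> 2 * R" "6 * R \<le> 2 ^ n * \<rho>"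
  shows "finite F \<and> real (card F) \<le> cD ^ n"
proof -
  have R: "0 < R" using assms by auto
  have fin: "real (card G) \<le> cD ^ n" if G: "finite G" "G \<subseteq> F" for G
  proof -
    have "real (card G) * measure M (ball x (2 * R)) = (\<Sum>z\<in>G. measure M (ball x (2 * R)))"
      by simp
    also have "\<dots> \<le> (\<Sum>z\<in>G. cD ^ n * measure M (ball z (\<rho> / 2)))"
    proof (rule sum_mono)
      fix z assume "z \<in> G"
      then have "dist x z < R" using G F by auto
      then show "measure M (ball x (2 * R)) \<le> cD ^ n * measure M (ball z (\<rho> / 2))"
        using assms R by (intro measure_ball_le) auto
    qed
    also have "\<dots> = cD ^ n * (\<Sum>z\<in>G. measure M (ball z (\<rho> / 2)))"
      by (simp add: sum_distrib_left)
    also have "(\<Sum>z\<in>G. measure M (ball z (\<rho> / 2))) = measure M (\<Union>z\<in>G. ball z (\<rho> / 2))"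
    proof (rule measure_finite_Union[symmetric])
      show "disjoint_family_on (\<lambda>z. ball z (\<rho> / 2)) G"
      proof (unfold disjoint_family_on_def, intro ballI impI, rule ccontr)
        fix y z assume yz: "y \<in> G" "z \<in> G" "y \<noteq> z" "ball y (\<rho> / 2) \<inter> ball z (\<rho> / 2) \<noteq> {}"
        then obtain v where "dist y v < \<rho> / 2" "dist z v < \<rho> / 2" by auto
        then have "dist y z < \<rho>" using dist_triangle2[of y z v] by simp
        then show False using yz(1-3) F(1) G(2) unfolding separated_def by (meson not_less subsetD)
      qed
      show "emeasure M (ball z (\<rho> / 2)) \<noteq> \<infinity>" for z
        using ball_finite[of "\<rho> / 2" z] assms by auto
    qed (use G in auto)
    also have "\<dots> \<le> measure M (ball x (2 * R))"
    proof (rule measure_mono_ball)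
      show "(\<Union>z\<in>G. ball z (\<rho> / 2)) \<subseteq> ball x (2 * R)"
      proof
        fix v assume "v \<in> (\<Union>z\<in>G. ball z (\<rho> / 2))"
        then obtain z where "z \<in> G" "dist z v < \<rho> / 2" by auto
        moreover from this have "dist x z < R" using G F by auto
        ultimately show "v \<in> ball x (2 * R)" using dist_triangle[of x v z] assms by simp
      qed
    qed (use R in \<open>auto intro!: borel_open\<close>)
    finally have "real (card G) * measure M (ball x (2 * R)) \<le> cD ^ n * measure M (ball x (2 * R))"
      using cD_ge_1 by (simp add: mult_left_mono)
    then show ?thesis using measure_ball_pos[of "2 * R" x] R by simp
  qed
  \<comment> \<open>The bound for finite subsets does not depend on the subset, so an infinite
    \<open>F\<close> would contain too large a finite one.\<close>
  have "finite F"
  proof (rule ccontr)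
    assume "infinite F"
    then obtain G where "finite G" "card G = nat \<lceil>cD ^ n\<rceil> + 1" "G \<subseteq> F"
      using infinite_arbitrarily_large by blast
    then show False using fin[of G] by linarith
  qed
  then show ?thesis using fin by blast
qed

text \<open>The packing count bounds the size of all separated subsets of \<open>A\<close>, so one
  of largest cardinality exists. A point it fails to cover could be added to it.\<close>

lemma maximal_separated_exists:
  assumes A: "A \<subseteq> ball x R" and "0 < \<rho>"
  obtains F where "finite F" "F \<subseteq> A" "separated \<rho> F" "\<And>a. a \<in> A \<Longrightarrow> \<exists>z\<in>F. dist a z < \<rho>"
proof -
  \<comment> \<open>The packing count needs rho to be at most twice the radius, whereas
    \<open>R\<close> may be small or even negative.\<close>
  define R' where "R' = max R \<rho>"
  obtain n where "6 * R' / \<rho> < 2 ^ n" using real_arch_pow[of 2 "6 * R' / \<rho>"] by auto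
  then have n: "6 * R' \<le> 2 ^ n * \<rho>" using assms by (simp add: field_simps)
  have bd: "finite F \<and> card F \<le> nat \<lceil>cD ^ n\<rceil>" if "F \<subseteq> A" "separated \<rho> F" for F
  proof -
    have "F \<subseteq> ball x R'" using that A unfolding R'_def by force
    then have "finite F \<and> real (card F) \<le> cD ^ n"
      using that assms n unfolding R'_def by (intro card_separated_le) auto
    then show ?thesis by linarith
  qed
  define P where "P F \<longleftrightarrow> F \<subseteq> A \<and> separated \<rho> F" for F
  have "P {}" by (simp add: P_def separated_def)
  then obtain F where F: "P F" "\<And>G. P G \<Longrightarrow> card G \<le> card F"
  proof -
    have "\<forall>F. P F \<longrightarrow> card F < Suc (nat \<lceil>cD ^ n\<rceil>)" using bd by (simp add: P_def less_Suc_eq_le)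
    then have "\<exists>F. P F \<and> (\<forall>G. P G \<longrightarrow> card G \<le> card F)"
      using \<open>P {}\<close> by (intro ex_has_greatest_nat)
    then show ?thesis using that by blast
  qed
  have "\<exists>z\<in>F. dist a z < \<rho>" if "a \<in> A" for a
  proof (rule ccontr)
    assume neg: "\<not> ?thesis"
    then have "a \<notin> F" using assms(2) by auto
    moreover have "P (insert a F)"
      using neg F that unfolding P_def separated_def by (auto simp: dist_commute not_less)
    ultimately show False using F(2)[of "insert a F"] F(1) bd[of F] unfolding P_def by simp
  qed
  then show ?thesis using that[of F] F bd unfolding P_def by blast
qed

text \<open>Closed balls are complete, and maximal separated sets make them totally bounded. This
  provides the uniform continuity of u used for the remainder of the chains.\<close>

lemma compact_cball_doubling: "compact (cball (x::'a) R)"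
  unfolding compact_eq_totally_bounded
proof safe
  show "complete (cball x R)" by (simp add: complete_eq_closed)
  fix e :: real assume "0 < e"
  have "cball x R \<subseteq> ball x (R + 1)" by auto
  from maximal_separated_exists[OF this \<open>0 < e\<close>] obtain F
    where F: "finite F" "\<And>a. a \<in> cball x R \<Longrightarrow> \<exists>z\<in>F. dist a z < e" by metis
  then show "\<exists>k. finite k \<and> cball x R \<subseteq> (\<Union>x\<in>k. ball x e)"
    by (intro exI[of _ F]) (auto simp: dist_commute)
qed

(* Lower semicontinuity by Fatou's lemma. Tonelli's theorem is not applicable directly: the type need
   not be second countable in the sense of the library, so f need not be jointly measurable. *)
lemma borel_measurable_nn_integral_continuous:
  fixes f :: "'a \<Rightarrow> 'a \<Rightarrow> real"
  assumes "\<And>y. continuous_on UNIV (\<lambda>x. f x y)" "\<And>x. f x \<in> borel_measurable M" "S \<in> sets M"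
  shows "(\<lambda>x. \<integral>\<^sup>+y\<in>S. ennreal (f x y) \<partial>M) \<in> borel_measurable M"
proof -
  let ?H = "\<lambda>x. \<integral>\<^sup>+y\<in>S. ennreal (f x y) \<partial>M"
  have "closed {x. ?H x \<le> a}" for a
    unfolding closed_sequential_limits
  proof (intro allI impI, elim conjE)
    fix X l assume X: "\<forall>n. X n \<in> {x. ?H x \<le> a}" "X \<longlonglongrightarrow> l"
    have "(\<lambda>n. f (X n) y) \<longlonglongrightarrow> f l y" for y
      using continuous_on_tendsto_compose[OF assms(1) X(2)] by auto
    then have lim: "(\<lambda>n. ennreal (f (X n) y)) \<longlonglongrightarrow> ennreal (f l y)" for y
      by (intro tendsto_ennrealI)
    have "?H l = (\<integral>\<^sup>+y. liminf (\<lambda>n. ennreal (f (X n) y) * indicator S y) \<partial>M)"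
    proof (rule nn_integral_cong)
      fix y
      have "(\<lambda>n. ennreal (f (X n) y) * indicator S y) \<longlonglongrightarrow> ennreal (f l y) * indicator S y"
        using lim[of y] by (auto simp: indicator_def)
      then show "ennreal (f l y) * indicator S y = liminf (\<lambda>n. ennreal (f (X n) y) * indicator S y)"
        by (simp add: lim_imp_Liminf)
    qed
    also have "\<dots> \<le> liminf (\<lambda>n. ?H (X n))"
      using assms(2,3)
      by (intro nn_integral_liminf borel_measurable_times_ennreal borel_measurable_indicator
          measurable_compose[OF assms(2) measurable_ennreal])
    also have "\<dots> \<le> a"
      using X by (intro Liminf_le) auto
    finally show "l \<in> {x. ?H x \<le> a}" by simp
  qed
  then have "{x \<in> space M. ?H x \<le> a} \<in> sets M" for a
    by simp
  then show ?thesis by (rule borel_measurableI_le)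
qed

section \<open>Power integrals, oscillations and bounded overlap\<close>

definition pow_integral :: "real \<Rightarrow> ('a \<Rightarrow> real) \<Rightarrow> 'a set \<Rightarrow> ennreal" where
  "pow_integral t u A = (\<integral>\<^sup>+x\<in>A. ennreal (\<bar>u x\<bar> powr t) \<partial>M)"

text \<open>An iterated integral, with \<open>A\<close> always the outer set. Everything below keeps
  this order, so that no exchange of the two integrals over the space occurs.\<close>

definition oscillation :: "real \<Rightarrow> ('a \<Rightarrow> real) \<Rightarrow> 'a set \<Rightarrow> 'a set \<Rightarrow> ennreal" where
  "oscillation t u A B = (\<integral>\<^sup>+x\<in>A. (\<integral>\<^sup>+y\<in>B. ennreal (\<bar>u x - u y\<bar> powr t) \<partial>M) \<partial>M)"

lemma measurable_pow:
  assumes "continuous_on UNIV u"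
  shows "(\<lambda>x. ennreal (\<bar>u x\<bar> powr t)) \<in> borel_measurable M"
    and "(\<lambda>y. ennreal (\<bar>u x - u y\<bar> powr t)) \<in> borel_measurable M"
proof -
  have [measurable]: "u \<in> borel_measurable M" using assms by (rule borel_measurable_M_continuous)
  show "(\<lambda>x. ennreal (\<bar>u x\<bar> powr t)) \<in> borel_measurable M" by measurable
  show "(\<lambda>y. ennreal (\<bar>u x - u y\<bar> powr t)) \<in> borel_measurable M" by measurable
qed

lemma measurable_inner_oscillation:
  assumes "continuous_on UNIV u" "0 < t" "B \<in> sets M"
  shows "(\<lambda>x. \<integral>\<^sup>+y\<in>B. ennreal (\<bar>u x - u y\<bar> powr t) \<partial>M) \<in> borel_measurable M"
proof (rule borel_measurable_nn_integral_continuous)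
  have [measurable]: "u \<in> borel_measurable M" using assms(1) by (rule borel_measurable_M_continuous)
  show "continuous_on UNIV (\<lambda>x. \<bar>u x - u y\<bar> powr t)" for y
    using assms by (intro continuous_on_powr' continuous_intros) auto
  show "(\<lambda>y. \<bar>u x - u y\<bar> powr t) \<in> borel_measurable M" for x
    by measurable
qed fact

text \<open>Apply \<open>ineq\<close> to |u x| <= |u y| + |u x - u y| and integrate over y in
  \<open>B\<close>, then x in \<open>A\<close>. The coefficients stay abstract because they change
  from one step of a chain to the next.\<close>

lemma pow_integral_compare:
  assumes u: "continuous_on UNIV u" and t: "0 < t" and sets: "A \<in> sets M" "B \<in> sets M"
    and nonneg: "0 \<le> a" "0 \<le> a'" "0 \<le> b"
    and ineq: "\<And>x y. 0 \<le> x \<Longrightarrow> 0 \<le> y \<Longrightarrow> a * (x + y) powr t \<le> a' * x powr t + b * y powr t"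
  shows "ennreal a * emeasure M B * pow_integral t u A
     \<le> ennreal a' * emeasure M A * pow_integral t u B + ennreal b * oscillation t u A B"
proof -
  let ?U = "\<lambda>x. ennreal (\<bar>u x\<bar> powr t)"
  let ?D = "\<lambda>x y. ennreal (\<bar>u x - u y\<bar> powr t)"
  let ?H = "\<lambda>x. \<integral>\<^sup>+y\<in>B. ?D x y \<partial>M"
  note [measurable] = measurable_pow[OF u] measurable_inner_oscillation[OF u t sets(2)] sets
  have pt: "ennreal a * ?U x \<le> ennreal a' * ?U y + ennreal b * ?D x y" for x y
  proof -
    have "a * \<bar>u x\<bar> powr t \<le> a * (\<bar>u y\<bar> + \<bar>u x - u y\<bar>) powr t"
      using t nonneg by (intro mult_left_mono powr_mono2) auto
    also have "\<dots> \<le> a' * \<bar>u y\<bar> powr t + b * \<bar>u x - u y\<bar> powr t"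
      by (rule ineq) auto
    finally show ?thesis
      using nonneg by (simp flip: ennreal_mult ennreal_plus)
  qed
  have inner: "ennreal a * emeasure M B * ?U x \<le> ennreal a' * pow_integral t u B + ennreal b * ?H x" for x
  proof -
    have "ennreal a * emeasure M B * ?U x = (\<integral>\<^sup>+y. (ennreal a * ?U x) * indicator B y \<partial>M)"
      using sets by (subst nn_integral_cmult_indicator) (auto simp: mult_ac)
    also have "\<dots> \<le> (\<integral>\<^sup>+y. ennreal a' * (?U y * indicator B y) + ennreal b * (?D x y * indicator B y) \<partial>M)"
      using pt by (intro nn_integral_mono) (auto simp: indicator_def)
    also have "\<dots> = ennreal a' * pow_integral t u B + ennreal b * ?H x"
      unfolding pow_integral_def
      by (subst nn_integral_add, measurable) (simp add: nn_integral_cmult)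
    finally show ?thesis .
  qed
  have "ennreal a * emeasure M B * pow_integral t u A
      = (\<integral>\<^sup>+x. (ennreal a * emeasure M B) * (?U x * indicator A x) \<partial>M)"
    unfolding pow_integral_def by (subst nn_integral_cmult) measurable
  also have "\<dots> \<le> (\<integral>\<^sup>+x. (ennreal a' * pow_integral t u B) * indicator A x + ennreal b * (?H x * indicator A x) \<partial>M)"
    using inner by (intro nn_integral_mono) (auto simp: indicator_def)
  also have "\<dots> = (ennreal a' * pow_integral t u B) * emeasure M A + ennreal b * oscillation t u A B"
    unfolding oscillation_def
    using sets by (subst nn_integral_add, measurable) (auto simp: nn_integral_cmult nn_integral_cmult_indicator)
  finally show ?thesis by (simp add: mult_ac)
qed

lemma sum_nn_integral_overlap_le:
  assumes f: "f \<in> borel_measurable M" and I: "finite I" "\<And>i. i \<in> I \<Longrightarrow> B i \<in> sets M" "S \<in> sets M"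
    and sub: "\<And>i. i \<in> I \<Longrightarrow> B i \<subseteq> S"
    and card: "\<And>y. real (card {i\<in>I. y \<in> B i}) \<le> P"
  shows "(\<Sum>i\<in>I. \<integral>\<^sup>+y\<in>B i. f y \<partial>M) \<le> ennreal P * (\<integral>\<^sup>+y\<in>S. f y \<partial>M)"
proof -
  have "(\<Sum>i\<in>I. \<integral>\<^sup>+y\<in>B i. f y \<partial>M) = (\<integral>\<^sup>+y. (\<Sum>i\<in>I. f y * indicator (B i) y) \<partial>M)"
    using f I by (intro nn_integral_sum[symmetric] borel_measurable_times_ennreal borel_measurable_indicator)
  also have "\<dots> \<le> (\<integral>\<^sup>+y. ennreal P * (f y * indicator S y) \<partial>M)"
  proof (rule nn_integral_mono)
    fix y
    have "(\<Sum>i\<in>I. f y * indicator (B i) y) = f y * (\<Sum>i\<in>I. indicator (B i) y)"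
      by (simp add: sum_distrib_left)
    also have "(\<Sum>i\<in>I. indicator (B i) y :: ennreal) = ennreal (real (card {i\<in>I. y \<in> B i}))"
      using I(1) by (simp add: indicator_def of_bool_def sum.If_cases Int_def ennreal_of_nat_eq_real_of_nat)
    also have "f y * \<dots> \<le> ennreal P * (f y * indicator S y)"
    proof (cases "y \<in> S")
      case True
      then show ?thesis using card[of y] by (simp add: mult.commute[of "f y"] mult_right_mono ennreal_leI)
    next
      case False
      then have none: "{i\<in>I. y \<in> B i} = {}" using sub by auto
      show ?thesis unfolding none by simp
    qed
    finally show "(\<Sum>i\<in>I. f y * indicator (B i) y) \<le> ennreal P * (f y * indicator S y)" .
  qed
  also have "\<dots> = ennreal P * (\<integral>\<^sup>+y\<in>S. f y \<partial>M)"
    using f I by (intro nn_integral_cmult borel_measurable_times_ennreal borel_measurable_indicator)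
  finally show ?thesis .
qed

lemma sum_oscillation_overlap_le:
  assumes u: "continuous_on UNIV u" and t: "0 < t"
    and I: "finite I" "\<And>i. i \<in> I \<Longrightarrow> B i \<in> sets M" "S \<in> sets M" "A \<in> sets M"
    and sub: "\<And>i. i \<in> I \<Longrightarrow> B i \<subseteq> S"
    and card: "\<And>y. real (card {i\<in>I. y \<in> B i}) \<le> P"
  shows "(\<Sum>i\<in>I. oscillation t u A (B i)) \<le> ennreal P * oscillation t u A S"
proof -
  let ?H = "\<lambda>B x. \<integral>\<^sup>+y\<in>B. ennreal (\<bar>u x - u y\<bar> powr t) \<partial>M"
  have meas: "(\<lambda>x. ?H C x * indicator A x) \<in> borel_measurable M" if "C \<in> sets M" for C
    using measurable_inner_oscillation[OF u t that] I(4)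
    by (intro borel_measurable_times_ennreal borel_measurable_indicator)
  have "(\<Sum>i\<in>I. oscillation t u A (B i)) = (\<integral>\<^sup>+x. (\<Sum>i\<in>I. ?H (B i) x * indicator A x) \<partial>M)"
    unfolding oscillation_def using I by (intro nn_integral_sum[symmetric] meas)
  also have "\<dots> \<le> (\<integral>\<^sup>+x. ennreal P * (?H S x * indicator A x) \<partial>M)"
  proof (rule nn_integral_mono)
    fix x
    have "(\<Sum>i\<in>I. ?H (B i) x) \<le> ennreal P * ?H S x"
      using measurable_pow(2)[OF u] I sub card by (intro sum_nn_integral_overlap_le)
    then show "(\<Sum>i\<in>I. ?H (B i) x * indicator A x) \<le> ennreal P * (?H S x * indicator A x)"
      by (cases "x \<in> A") (simp_all add: indicator_def)
  qed
  also have "\<dots> = ennreal P * oscillation t u A S"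
    unfolding oscillation_def using I by (intro nn_integral_cmult meas)
  finally show ?thesis .
qed

end

section \<open>Chains through nets of a thick set\<close>

text \<open>The nets cover only part of E around w, so covering is demanded just where it is used:
  \<open>net_child\<close> for descending one level, \<open>net_cover\<close> for reaching the
  points of B near E. \<open>net_ball\<close> keeps the enlarged cells inside 3B. In
  \<open>thick\<close> the diameter condition is replaced by R <= r and the quotient is
  cleared.\<close>

locale thick_nets = doubling_space M cD for M :: "'a::complete_space measure" and cD :: real +
  fixes E :: "'a set" and c Q lam r :: real and w :: 'a and \<rho> :: "nat \<Rightarrow> real" and N :: "nat \<Rightarrow> 'a set"
  assumes c_pos: "0 < c" and lam_pos: "0 < lam" and lam_le: "lam \<le> 1 / 8" and r_pos: "0 < r"
    and rho: "\<rho> j = lam ^ j * r"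
    and thick: "\<And>x r' R. x \<in> E \<Longrightarrow> 0 < r' \<Longrightarrow> r' < R \<Longrightarrow> R \<le> r \<Longrightarrow>
      c * (r' / R) powr Q * measure M (ball x R) \<le> measure M (open_nbhd E r' \<inter> ball x R)"
    and net_finite: "finite (N j)" and net_subset: "N j \<subseteq> E" and net_separated: "separated (\<rho> j) (N j)"
    and net_ball: "\<And>z. z \<in> N j \<Longrightarrow> dist w z + 3 * \<rho> j \<le> 3 * r"
    and net_child: "\<And>z e. z \<in> N j \<Longrightarrow> e \<in> E \<Longrightarrow> dist z e < \<rho> j + \<rho> (Suc j) \<Longrightarrow>
      \<exists>z'\<in>N (Suc j). dist e z' < \<rho> (Suc j)"
    and net_cover: "\<And>x. dist w x < r \<Longrightarrow> infdist x E < \<rho> j \<Longrightarrow> \<exists>z\<in>N j. dist x z < 2 * \<rho> j"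
begin

text \<open>The factor 2 arises from two steps of length below rho_j: from a point near E to a point
  of E, and from there to the net.\<close>

abbreviation "net_cell j z \<equiv> ball z (2 * \<rho> j)"
abbreviation "cell_mass j z \<equiv> measure M (net_cell j z)"
definition "children j z = {z' \<in> N (Suc j). dist z z' < 2 * \<rho> j}"
definition "child_mass j z = (\<Sum>z'\<in>children j z. cell_mass (Suc j) z')"
text \<open>The bound for the growth of densities in one step: cD / (c lam^Q) bounds the mass of a
  cell relative to its children, and the remaining cD^4 bounds the number of parents.\<close>

definition "K = cD ^ 5 / (c * lam powr Q)"
text \<open>The radius 3 rho_j is large enough to contain all child cells, since 2 rho_j + 2
  rho_(j+1) < 3 rho_j. Division by the cell mass turns the inner integral into an average up to
  constants.\<close>

definition "energy t u j = (\<Sum>z\<in>N j. ennreal (1 / cell_mass j z) * oscillation t u (net_cell j z) (ball z (3 * \<rho> j)))"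

lemma rho_pos: "0 < \<rho> j"
  using lam_pos r_pos by (simp add: rho)

lemma rho_Suc: "\<rho> (Suc j) = lam * \<rho> j"
  by (simp add: rho)

lemma rho_Suc_le: "8 * \<rho> (Suc j) \<le> \<rho> j"
  using mult_right_mono[OF lam_le, of "\<rho> j"] rho_pos[of j] by (simp add: rho_Suc)

lemma rho_le: "\<rho> j \<le> r"
  using lam_pos lam_le r_pos by (simp add: rho power_le_one mult_le_cancel_right1)

lemma cell_mass_pos: "0 < cell_mass j z"
  using rho_pos by (intro measure_ball_pos) auto

lemma K_pos: "0 < K"
  unfolding K_def using cD_ge_1 c_pos lam_pos by auto

lemma finite_children: "finite (children j z)"
  unfolding children_def using net_finite by auto

text \<open>The net points in question lie within 2 rho_j of y, and the packing count applies with n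
  = 4 because 6 * 2 <= 2^4.\<close>

lemma card_net_overlap: "real (card {z \<in> N j. y \<in> net_cell j z}) \<le> cD ^ 4"
proof -
  have "separated (\<rho> j) {z \<in> N j. y \<in> net_cell j z}"
    using net_separated[of j] unfolding separated_def by auto
  then show ?thesis
    using card_separated_le[of "\<rho> j" "{z \<in> N j. y \<in> net_cell j z}" y "2 * \<rho> j" 4] rho_pos[of j]
    by (auto simp: dist_commute subset_iff)
qed

text \<open>The place where the codimension bound enters, with radii rho_(j+1) < rho_j. The part of
  \<open>ball z (\<rho> j)\<close> within rho_(j+1) of E is covered by the child cells: go to a
  nearby point of E, then to a net point of the next level. One doubling passes from radius rho_j to
  the cell.\<close>

lemma cell_mass_le_child_mass:
  assumes "z \<in> N j"
  shows "cell_mass j z \<le> cD / (c * lam powr Q) * child_mass j z"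
proof -
  have "c * lam powr Q * measure M (ball z (\<rho> j))
      \<le> measure M (open_nbhd E (\<rho> (Suc j)) \<inter> ball z (\<rho> j))"
  proof -
    have "\<rho> (Suc j) < \<rho> j" "z \<in> E"
      using rho_pos[of j] rho_Suc_le[of j] assms net_subset[of j] by auto
    then show ?thesis
      using thick[of z "\<rho> (Suc j)" "\<rho> j"] rho_pos[of j] rho_pos[of "Suc j"] rho_le[of j]
      by (simp add: rho_Suc)
  qed
  also have "\<dots> \<le> measure M (\<Union>z'\<in>children j z. net_cell (Suc j) z')"
  proof (rule measure_mono_fmeasurable)
    show "open_nbhd E (\<rho> (Suc j)) \<inter> ball z (\<rho> j) \<subseteq> (\<Union>z'\<in>children j z. net_cell (Suc j) z')"
    proof safe
      fix x assume x: "x \<in> open_nbhd E (\<rho> (Suc j))" "x \<in> ball z (\<rho> j)"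
      have "E \<noteq> {}" using assms net_subset[of j] by auto
      then obtain e where e: "e \<in> E" "dist x e < \<rho> (Suc j)"
        using x(1) unfolding open_nbhd_def by (auto simp: infdist_def cINF_less_iff split: if_splits)
      have "dist z e < \<rho> j + \<rho> (Suc j)" using dist_triangle[of z e x] e x(2) by simp
      then obtain z' where z': "z' \<in> N (Suc j)" "dist e z' < \<rho> (Suc j)"
        using net_child[OF assms e(1)] by auto
      have "dist z z' < 2 * \<rho> j"
        using dist_triangle[of z z' e] \<open>dist z e < _\<close> z'(2) rho_Suc_le[of j] rho_pos[of "Suc j"] by linarith
      moreover have "dist z' x < 2 * \<rho> (Suc j)"
        using dist_triangle[of z' x e] e(2) z'(2) by (simp add: dist_commute)
      ultimately show "x \<in> (\<Union>z'\<in>children j z. net_cell (Suc j) z')"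
        using z'(1) by (auto simp: children_def)
    qed
    show "open_nbhd E (\<rho> (Suc j)) \<inter> ball z (\<rho> j) \<in> sets M"
      unfolding open_nbhd_def by (simp, intro borel_open open_Int open_Collect_less continuous_intros) auto
    show "(\<Union>z'\<in>children j z. net_cell (Suc j) z') \<in> fmeasurable M"
      using finite_children ball_finite rho_pos[of "Suc j"]
      by (intro fmeasurable.finite_UN) (auto simp: fmeasurable_def)
  qed
  also have "\<dots> \<le> child_mass j z"
    unfolding child_mass_def using finite_children by (intro measure_UNION_le) auto
  finally have le: "c * lam powr Q * measure M (ball z (\<rho> j)) \<le> child_mass j z" .
  have pos: "0 < c * lam powr Q" using c_pos lam_pos by auto
  have "cell_mass j z \<le> cD * measure M (ball z (\<rho> j))"
    using rho_pos[of j] by (rule doubling)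
  also have "\<dots> \<le> cD * (child_mass j z / (c * lam powr Q))"
    using le pos cD_ge_1 by (intro mult_left_mono) (auto simp: field_simps)
  finally show ?thesis by simp
qed

lemma child_mass_pos: "z \<in> N j \<Longrightarrow> 0 < child_mass j z"
  using cell_mass_le_child_mass[of z j] cell_mass_pos[of z j] c_pos lam_pos cD_ge_1
  by (smt (verit) divide_nonneg_pos mult_nonneg_nonpos mult_pos_pos powr_gt_zero)

text \<open>Here \<open>q\<close> is a density: the mass at z is \<open>q z * cell_mass j z\<close>.
  The transition probability to z' is \<open>cell_mass (Suc j) z' / child_mass j z\<close>; dividing
  by the mass of the new cell to obtain a density again cancels its numerator.\<close>

definition push :: "nat \<Rightarrow> ('a \<Rightarrow> real) \<Rightarrow> 'a \<Rightarrow> real" where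
  "push j q z' = (\<Sum>z | z \<in> N j \<and> z' \<in> children j z. q z * cell_mass j z / child_mass j z)"

lemma push_nonneg:
  assumes "\<And>z. z \<in> N j \<Longrightarrow> 0 \<le> q z"
  shows "0 \<le> push j q z'"
  unfolding push_def using assms child_mass_pos cell_mass_pos
  by (intro sum_nonneg divide_nonneg_nonneg mult_nonneg_nonneg) (auto simp: less_imp_le)

text \<open>Each parent of z' contributes at most the mass ratio times kappa, and z' lies in the
  cells of all its parents, so the overlap bound counts them.\<close>

lemma push_le:
  assumes "\<And>z. z \<in> N j \<Longrightarrow> 0 \<le> q z" "\<And>z. z \<in> N j \<Longrightarrow> q z \<le> \<kappa>" "0 \<le> \<kappa>"
  shows "push j q z' \<le> K * \<kappa>"
proof -
  let ?D = "cD / (c * lam powr Q)"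
  have D: "0 \<le> ?D" using cD_ge_1 c_pos lam_pos by auto
  have "push j q z' \<le> (\<Sum>z | z \<in> N j \<and> z' \<in> children j z. ?D * \<kappa>)"
    unfolding push_def
  proof (rule sum_mono)
    fix z assume "z \<in> {z. z \<in> N j \<and> z' \<in> children j z}"
    then have z: "z \<in> N j" by auto
    have "q z * (cell_mass j z / child_mass j z) \<le> \<kappa> * ?D"
      using assms z cell_mass_le_child_mass[OF z] child_mass_pos[OF z]
      by (intro mult_mono) (auto simp: pos_divide_le_eq)
    then show "q z * cell_mass j z / child_mass j z \<le> ?D * \<kappa>" by (simp add: mult_ac)
  qed
  also have "\<dots> = real (card {z. z \<in> N j \<and> z' \<in> children j z}) * (?D * \<kappa>)" by simp
  also have "\<dots> \<le> cD ^ 4 * (?D * \<kappa>)"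
  proof (rule mult_right_mono)
    have "card {z. z \<in> N j \<and> z' \<in> children j z} \<le> card {z \<in> N j. z' \<in> net_cell j z}"
      using net_finite[of j] by (intro card_mono) (auto simp: children_def)
    then show "real (card {z. z \<in> N j \<and> z' \<in> children j z}) \<le> cD ^ 4"
      using card_net_overlap[of j z'] by linarith
  qed (use assms D in \<open>intro mult_nonneg_nonneg\<close>)
  also have "\<dots> = K * \<kappa>" by (simp add: K_def power_numeral_reduce)
  finally show ?thesis .
qed

text \<open>The transition probabilities out of each z sum to one. Conservation of mass keeps the
  remainder of a chain bounded independently of its length.\<close>

lemma push_mass: "(\<Sum>z'\<in>N (Suc j). push j q z' * cell_mass (Suc j) z') = (\<Sum>z\<in>N j. q z * cell_mass j z)"
proof -
  have "(\<Sum>z'\<in>N (Suc j). push j q z' * cell_mass (Suc j) z')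
      = (\<Sum>z'\<in>N (Suc j). \<Sum>z | z \<in> N j \<and> z' \<in> children j z.
          q z * cell_mass j z / child_mass j z * cell_mass (Suc j) z')"
    by (simp add: push_def sum_distrib_right)
  also have "\<dots> = (\<Sum>z\<in>N j. \<Sum>z' | z' \<in> N (Suc j) \<and> z' \<in> children j z.
          q z * cell_mass j z / child_mass j z * cell_mass (Suc j) z')"
    by (rule sum.swap_restrict) (auto simp: net_finite)
  also have "\<dots> = (\<Sum>z\<in>N j. q z * cell_mass j z)"
  proof (rule sum.cong[OF refl])
    fix z assume z: "z \<in> N j"
    have "{z'. z' \<in> N (Suc j) \<and> z' \<in> children j z} = children j z" by (auto simp: children_def)
    then have "(\<Sum>z' | z' \<in> N (Suc j) \<and> z' \<in> children j z.
          q z * cell_mass j z / child_mass j z * cell_mass (Suc j) z')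
        = q z * cell_mass j z / child_mass j z * child_mass j z"
      by (simp add: sum_distrib_left child_mass_def)
    then show "(\<Sum>z' | z' \<in> N (Suc j) \<and> z' \<in> children j z.
          q z * cell_mass j z / child_mass j z * cell_mass (Suc j) z') = q z * cell_mass j z"
      using child_mass_pos[OF z] by simp
  qed
  finally show ?thesis .
qed

lemma sum_children_swap:
  fixes f :: "'a \<Rightarrow> 'a \<Rightarrow> ennreal"
  shows "(\<Sum>z\<in>N j. \<Sum>z'\<in>children j z. f z z') = (\<Sum>z'\<in>N (Suc j). \<Sum>z | z \<in> N j \<and> z' \<in> children j z. f z z')"
proof -
  have "{z' \<in> N (Suc j). z' \<in> children j z} = children j z" for z by (auto simp: children_def)
  then show ?thesis
    using sum.swap_restrict[of "N j" "N (Suc j)" f "\<lambda>z z'. z' \<in> children j z"] net_finite by simp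
qed

text \<open>\<open>pow_integral_compare\<close> between a cell and each of its child cells, summed
  over the children. Since the child cells overlap at most cD^4 times, their oscillations merge into
  one.\<close>

lemma pow_integral_child_le:
  assumes u: "continuous_on UNIV u" and t: "0 < t" and z: "z \<in> N j"
    and nonneg: "0 \<le> a" "0 \<le> a'" "0 \<le> b"
    and ineq: "\<And>x y. 0 \<le> x \<Longrightarrow> 0 \<le> y \<Longrightarrow> a * (x + y) powr t \<le> a' * x powr t + b * y powr t"
  shows "ennreal a * (ennreal (child_mass j z) * pow_integral t u (net_cell j z))
    \<le> ennreal a' * (ennreal (cell_mass j z) * (\<Sum>z'\<in>children j z. pow_integral t u (net_cell (Suc j) z')))
      + ennreal b * (ennreal (cD ^ 4) * oscillation t u (net_cell j z) (ball z (3 * \<rho> j)))"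
proof -
  let ?W = "\<lambda>j z. pow_integral t u (net_cell j z)"
  let ?O = "\<lambda>z'. oscillation t u (net_cell j z) (net_cell (Suc j) z')"
  have em: "emeasure M (net_cell i y) = ennreal (cell_mass i y)" for i y
    using rho_pos[of i] by (intro emeasure_ball) auto
  have "ennreal a * (ennreal (child_mass j z) * ?W j z)
      = (\<Sum>z'\<in>children j z. ennreal a * ennreal (cell_mass (Suc j) z') * ?W j z)"
    unfolding child_mass_def by (simp add: sum_distrib_left sum_distrib_right mult_ac flip: sum_ennreal)
  also have "\<dots> \<le> (\<Sum>z'\<in>children j z. ennreal a' * ennreal (cell_mass j z) * ?W (Suc j) z' + ennreal b * ?O z')"
    using pow_integral_compare[OF u t _ _ nonneg ineq] unfolding em[symmetric]
    by (intro sum_mono) auto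
  also have "\<dots> = ennreal a' * (ennreal (cell_mass j z) * (\<Sum>z'\<in>children j z. ?W (Suc j) z'))
      + ennreal b * (\<Sum>z'\<in>children j z. ?O z')"
    by (simp add: sum.distrib sum_distrib_left mult_ac)
  also have "(\<Sum>z'\<in>children j z. ?O z') \<le> ennreal (cD ^ 4) * oscillation t u (net_cell j z) (ball z (3 * \<rho> j))"
  proof (rule sum_oscillation_overlap_le[OF u t finite_children])
    show "net_cell (Suc j) z' \<subseteq> ball z (3 * \<rho> j)" if "z' \<in> children j z" for z'
      using that rho_Suc_le[of j] rho_pos[of "Suc j"]
      by (intro ball_subset_ball_dist) (auto simp: children_def dist_commute)
    fix y
    have "card {i \<in> children j z. y \<in> net_cell (Suc j) i} \<le> card {z \<in> N (Suc j). y \<in> net_cell (Suc j) z}"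
      using net_finite by (intro card_mono) (auto simp: children_def)
    then show "real (card {i \<in> children j z. y \<in> net_cell (Suc j) i}) \<le> cD ^ 4"
      using card_net_overlap[of "Suc j" y] by linarith
  qed auto
  finally show ?thesis by (simp add: add_left_mono mult_left_mono)
qed

text \<open>One random step, averaged over the starting points with density \<open>q\<close>. In
  this use of \<open>K\<close> the factor cD^4 comes from the overlap of child cells, not from the
  number of parents.\<close>

lemma pow_integral_push_le:
  assumes u: "continuous_on UNIV u" and t: "0 < t"
    and q: "\<And>z. z \<in> N j \<Longrightarrow> 0 \<le> q z" "\<And>z. z \<in> N j \<Longrightarrow> q z \<le> \<kappa>" "0 \<le> \<kappa>"
    and nonneg: "0 \<le> a" "0 \<le> a'" "0 \<le> b"
    and ineq: "\<And>x y. 0 \<le> x \<Longrightarrow> 0 \<le> y \<Longrightarrow> a * (x + y) powr t \<le> a' * x powr t + b * y powr t"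
  shows "ennreal a * (\<Sum>z\<in>N j. ennreal (q z) * pow_integral t u (net_cell j z))
    \<le> ennreal a' * (\<Sum>z\<in>N (Suc j). ennreal (push j q z) * pow_integral t u (net_cell (Suc j) z))
      + ennreal (b * \<kappa> * K) * energy t u j"
proof -
  let ?W = "\<lambda>j z. pow_integral t u (net_cell j z)"
  let ?O = "\<lambda>z. oscillation t u (net_cell j z) (ball z (3 * \<rho> j))"
  let ?p = "\<lambda>z. q z * cell_mass j z / child_mass j z"
  have p: "0 \<le> ?p z" if "z \<in> N j" for z
    using that q child_mass_pos[OF that] by simp
  have single: "ennreal a * (ennreal (q z) * ?W j z)
      \<le> ennreal a' * (\<Sum>z'\<in>children j z. ennreal (?p z) * ?W (Suc j) z')
        + ennreal (b * \<kappa> * K) * (ennreal (1 / cell_mass j z) * ?O z)" if z: "z \<in> N j" for z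
  proof -
    \<comment> \<open>Multiplying the estimate for a single cell by \<open>h\<close> makes its left
      side the term with density \<open>q z\<close> and produces the transition weights on the
      right.\<close>
    define h where "h = q z / child_mass j z"
    have h: "0 \<le> h" using q z child_mass_pos[OF z] by (simp add: h_def)
    have hq: "ennreal h * ennreal (child_mass j z) = ennreal (q z)"
      using h child_mass_pos[OF z] by (simp add: ennreal_mult[symmetric]) (simp add: h_def)
    have hp: "ennreal h * ennreal (cell_mass j z) = ennreal (?p z)"
      using h by (simp add: ennreal_mult[symmetric]) (simp add: h_def)
    have hb: "ennreal h * (ennreal b * ennreal (cD ^ 4)) = ennreal (h * b * cD ^ 4)"
      using h nonneg cD_ge_1 by (simp add: ennreal_mult mult_ac)
    have "ennreal a * (ennreal (q z) * ?W j z) = ennreal h * (ennreal a * (ennreal (child_mass j z) * ?W j z))"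
      unfolding hq[symmetric] by (simp only: mult_ac)
    also have "\<dots> \<le> ennreal h * (ennreal a' * (ennreal (cell_mass j z) * (\<Sum>z'\<in>children j z. ?W (Suc j) z'))
        + ennreal b * (ennreal (cD ^ 4) * ?O z))"
      by (intro mult_left_mono pow_integral_child_le[OF u t z nonneg ineq]) auto
    also have "\<dots> = ennreal a' * (\<Sum>z'\<in>children j z. ennreal (?p z) * ?W (Suc j) z')
        + ennreal (h * b * cD ^ 4) * ?O z"
      unfolding hp[symmetric] hb[symmetric] sum_distrib_left[symmetric] by (simp only: distrib_left mult_ac)
    also have "ennreal (h * b * cD ^ 4) * ?O z \<le> ennreal (b * \<kappa> * K) * (ennreal (1 / cell_mass j z) * ?O z)"
    proof -
      \<comment> \<open>The mass ratio bounds \<open>h\<close> by a multiple of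
        \<open>1 / cell_mass j z\<close>, which is the normalisation in
        \<open>energy\<close>.\<close>
      have "h * cell_mass j z \<le> \<kappa> * (cD / (c * lam powr Q))"
        using cell_mass_le_child_mass[OF z] child_mass_pos[OF z] q z
          mult_mono[of "q z" \<kappa> "cell_mass j z / child_mass j z" "cD / (c * lam powr Q)"]
        by (simp add: h_def pos_divide_le_eq)
      then have "h * cell_mass j z * (b * cD ^ 4) \<le> \<kappa> * (cD / (c * lam powr Q)) * (b * cD ^ 4)"
        using nonneg cD_ge_1 by (intro mult_right_mono) auto
      then have "h * b * cD ^ 4 * cell_mass j z \<le> b * \<kappa> * K"
        by (simp add: K_def mult_ac power_numeral_reduce)
      then have "h * b * cD ^ 4 \<le> b * \<kappa> * K * (1 / cell_mass j z)"
        using cell_mass_pos[of z j] by (simp add: pos_le_divide_eq)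
      then have "ennreal (h * b * cD ^ 4) \<le> ennreal (b * \<kappa> * K) * ennreal (1 / cell_mass j z)"
        using nonneg q K_pos cell_mass_pos[of z j] by (subst ennreal_mult[symmetric]) (auto intro!: ennreal_leI)
      then show ?thesis by (simp add: mult.assoc[symmetric] mult_right_mono)
    qed
    finally show ?thesis by (simp add: add_left_mono)
  qed
  have "ennreal a * (\<Sum>z\<in>N j. ennreal (q z) * ?W j z) = (\<Sum>z\<in>N j. ennreal a * (ennreal (q z) * ?W j z))"
    by (simp add: sum_distrib_left)
  also have "\<dots> \<le> (\<Sum>z\<in>N j. ennreal a' * (\<Sum>z'\<in>children j z. ennreal (?p z) * ?W (Suc j) z')
        + ennreal (b * \<kappa> * K) * (ennreal (1 / cell_mass j z) * ?O z))"
    by (intro sum_mono single)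
  also have "\<dots> = ennreal a' * (\<Sum>z\<in>N j. \<Sum>z'\<in>children j z. ennreal (?p z) * ?W (Suc j) z')
        + ennreal (b * \<kappa> * K) * energy t u j"
    by (simp add: sum.distrib sum_distrib_left energy_def)
  also have "(\<Sum>z\<in>N j. \<Sum>z'\<in>children j z. ennreal (?p z) * ?W (Suc j) z')
      = (\<Sum>z'\<in>N (Suc j). ennreal (push j q z') * ?W (Suc j) z')"
    unfolding sum_children_swap push_def
    by (intro sum.cong refl) (subst sum_ennreal[symmetric], use p in blast, simp only: sum_distrib_right)
  finally show ?thesis .
qed

text \<open>Iterating the random step n times. The density is general because the induction replaces
  \<open>q\<close> by its push and its bound kappa by K kappa. The index \<open>i\<close> counts
  steps and is separate from the level \<open>j\<close>, as chains start at every level.\<close>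

lemma weighted_pow_integral_le:
  assumes u: "continuous_on UNIV u" and t: "0 < t"
    and a: "\<And>i. 0 \<le> a i" "\<And>i. a i \<le> 1" and b: "\<And>i. 0 \<le> b i"
    and ineq: "\<And>i x y. 0 \<le> x \<Longrightarrow> 0 \<le> y \<Longrightarrow>
      a i * (x + y) powr t \<le> a (Suc i) * x powr t + b i * y powr t"
    and \<epsilon>: "\<And>z x. z \<in> N (j + n) \<Longrightarrow> x \<in> net_cell (j + n) z \<Longrightarrow> \<bar>u x\<bar> powr t \<le> \<epsilon>" "0 \<le> \<epsilon>"
    and q: "\<And>z. z \<in> N j \<Longrightarrow> 0 \<le> q z" "\<And>z. z \<in> N j \<Longrightarrow> q z \<le> \<kappa>" "0 \<le> \<kappa>"
  shows "ennreal (a i) * (\<Sum>z\<in>N j. ennreal (q z) * pow_integral t u (net_cell j z))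
    \<le> ennreal ((\<Sum>z\<in>N j. q z * cell_mass j z) * \<epsilon>)
      + (\<Sum>l<n. ennreal (b (i + l) * \<kappa> * K ^ Suc l) * energy t u (j + l))"
  using \<epsilon>(1) q
proof (induction n arbitrary: i j q \<kappa>)
  case 0
  have W: "pow_integral t u (net_cell j z) \<le> ennreal (\<epsilon> * cell_mass j z)" if "z \<in> N j" for z
  proof -
    have "pow_integral t u (net_cell j z) \<le> (\<integral>\<^sup>+x. ennreal \<epsilon> * indicator (net_cell j z) x \<partial>M)"
      unfolding pow_integral_def using that 0
      by (intro nn_integral_mono) (auto simp: indicator_def intro!: ennreal_leI)
    also have "\<dots> = ennreal \<epsilon> * emeasure M (net_cell j z)"
      by (subst nn_integral_cmult_indicator) auto
    also have "\<dots> = ennreal (\<epsilon> * cell_mass j z)"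
      using \<epsilon>(2) rho_pos[of j] by (simp add: emeasure_ball ennreal_mult)
    finally show ?thesis .
  qed
  have "ennreal (a i) * (\<Sum>z\<in>N j. ennreal (q z) * pow_integral t u (net_cell j z))
      \<le> ennreal 1 * (\<Sum>z\<in>N j. ennreal (q z) * ennreal (\<epsilon> * cell_mass j z))"
    using a W by (intro mult_mono sum_mono ennreal_leI) auto
  also have "\<dots> = ennreal ((\<Sum>z\<in>N j. q z * cell_mass j z) * \<epsilon>)"
    using 0 \<epsilon>(2) by (simp add: ennreal_mult[symmetric] sum_ennreal sum_distrib_left mult_ac)
  finally show ?case by simp
next
  case (Suc n)
  let ?W = "\<lambda>j z. pow_integral t u (net_cell j z)"
  have "ennreal (a i) * (\<Sum>z\<in>N j. ennreal (q z) * ?W j z)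
    \<le> ennreal (a (Suc i)) * (\<Sum>z\<in>N (Suc j). ennreal (push j q z) * ?W (Suc j) z)
      + ennreal (b i * \<kappa> * K) * energy t u j"
    using a b ineq Suc.prems(2-) by (intro pow_integral_push_le[OF u t]) auto
  \<comment> \<open>The induction hypothesis one level down, for the pushed density;
    \<open>push_mass\<close> then restores the original total mass in the remainder.\<close>
  also have "ennreal (a (Suc i)) * (\<Sum>z\<in>N (Suc j). ennreal (push j q z) * ?W (Suc j) z)
     \<le> ennreal ((\<Sum>z\<in>N (Suc j). push j q z * cell_mass (Suc j) z) * \<epsilon>)
      + (\<Sum>l<n. ennreal (b (Suc i + l) * (K * \<kappa>) * K ^ Suc l) * energy t u (Suc j + l))"
    using Suc.prems K_pos by (intro Suc.IH push_nonneg push_le) auto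
  also have "(\<Sum>z\<in>N (Suc j). push j q z * cell_mass (Suc j) z) = (\<Sum>z\<in>N j. q z * cell_mass j z)"
    by (rule push_mass)
  finally show ?case
    unfolding sum.lessThan_Suc_shift
    by (simp add: add_right_mono mult_ac add_ac)
qed

lemma net_cell_subset: "z \<in> N j \<Longrightarrow> net_cell j z \<subseteq> ball w (3 * r)"
  using net_ball[of z j] rho_pos[of j] by (intro ball_subset_ball_dist) (auto simp: dist_commute)

text \<open>u vanishes at the centres of the cells, the cells shrink, and u is uniformly continuous
  on the compact ball of radius 3r.\<close>

lemma eventually_small_near_nets:
  fixes u :: "'a \<Rightarrow> real" and t \<epsilon> :: real
  assumes u: "continuous_on UNIV u" "\<And>x. x \<in> E \<Longrightarrow> u x = 0" and t: "0 < t" and "0 < \<epsilon>"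
  obtains n where "\<And>j z x. n \<le> j \<Longrightarrow> z \<in> N j \<Longrightarrow> x \<in> net_cell j z \<Longrightarrow> \<bar>u x\<bar> powr t \<le> \<epsilon>"
proof -
  have "uniformly_continuous_on (cball w (3 * r)) u"
    using u(1) by (intro compact_uniformly_continuous compact_cball_doubling)
      (auto intro: continuous_on_subset)
  moreover have "0 < \<epsilon> powr (1 / t)" using assms by simp
  ultimately obtain d where d: "0 < d"
    "\<And>x y. x \<in> cball w (3 * r) \<Longrightarrow> y \<in> cball w (3 * r) \<Longrightarrow> dist y x < d \<Longrightarrow> dist (u y) (u x) < \<epsilon> powr (1 / t)"
    unfolding uniformly_continuous_on_def by metis
  have "(\<lambda>j. 2 * \<rho> j) \<longlonglongrightarrow> 2 * (0 * r)"
    unfolding rho using lam_pos lam_le by (intro tendsto_intros LIMSEQ_power_zero) auto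
  then have "\<forall>\<^sub>F j in sequentially. 2 * \<rho> j < d"
    using d(1) by (intro order_tendstoD) auto
  then obtain n where n: "\<And>j. n \<le> j \<Longrightarrow> 2 * \<rho> j < d" by (auto simp: eventually_sequentially)
  have "\<bar>u x\<bar> powr t \<le> \<epsilon>" if "n \<le> j" "z \<in> N j" "x \<in> net_cell j z" for j z x
  proof -
    have "z \<in> net_cell j z" using rho_pos[of j] by simp
    then have "dist (u z) (u x) < \<epsilon> powr (1 / t)"
      using net_cell_subset[OF that(2)] that n[OF that(1)] by (intro d(2)) fastforce+
    moreover have "u z = 0" using that net_subset[of j] u(2) by auto
    ultimately have "\<bar>u x\<bar> powr t \<le> (\<epsilon> powr (1 / t)) powr t"
      using t by (intro powr_mono2) (auto simp: dist_real_def)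
    then show ?thesis using assms by (simp add: powr_powr)
  qed
  then show ?thesis by (rule that)
qed

text \<open>Start from the constant density 1 and let the number of steps tend to infinity.\<close>

lemma sum_pow_integral_le_energy:
  assumes u: "continuous_on UNIV u" "\<And>x. x \<in> E \<Longrightarrow> u x = 0" and t: "0 < t"
    and a: "\<And>i. 0 \<le> a i" "\<And>i. a i \<le> 1" and b: "\<And>i. 0 \<le> b i"
    and ineq: "\<And>i x y. 0 \<le> x \<Longrightarrow> 0 \<le> y \<Longrightarrow>
      a i * (x + y) powr t \<le> a (Suc i) * x powr t + b i * y powr t"
  shows "ennreal (a 0) * (\<Sum>z\<in>N j. pow_integral t u (net_cell j z))
    \<le> (\<Sum>l. ennreal (b l * K ^ Suc l) * energy t u (j + l))"
proof (rule ennreal_le_epsilon)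
  fix e :: real assume e: "0 < e"
  \<comment> \<open>The tolerance e / (m + 1) makes the remainder at most e, also when m =
    0.\<close>
  define m where "m = (\<Sum>z\<in>N j. cell_mass j z)"
  have m: "0 \<le> m" unfolding m_def by (simp add: sum_nonneg)
  obtain n where n: "\<And>j z x. n \<le> j \<Longrightarrow> z \<in> N j \<Longrightarrow> x \<in> net_cell j z \<Longrightarrow> \<bar>u x\<bar> powr t \<le> e / (m + 1)"
    using eventually_small_near_nets[OF u t, of "e / (m + 1)"] e m by auto
  have "ennreal (a 0) * (\<Sum>z\<in>N j. ennreal 1 * pow_integral t u (net_cell j z))
    \<le> ennreal ((\<Sum>z\<in>N j. 1 * cell_mass j z) * (e / (m + 1)))
      + (\<Sum>l<n. ennreal (b (0 + l) * 1 * K ^ Suc l) * energy t u (j + l))"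
    using n[of "j + n"] e m
    by (intro weighted_pow_integral_le[where a = a and b = b and q = "\<lambda>_. 1" and i = 0, OF u(1) t a b ineq]) auto
  also have "ennreal ((\<Sum>z\<in>N j. 1 * cell_mass j z) * (e / (m + 1))) \<le> ennreal e"
    unfolding mult_1 m_def[symmetric] using e m by (intro ennreal_leI) (simp add: field_simps)
  also have "(\<Sum>l<n. ennreal (b (0 + l) * 1 * K ^ Suc l) * energy t u (j + l))
      \<le> (\<Sum>l. ennreal (b l * K ^ Suc l) * energy t u (j + l))"
    by (simp add: sum_le_suminf)
  finally show "ennreal (a 0) * (\<Sum>z\<in>N j. pow_integral t u (net_cell j z))
      \<le> (\<Sum>l. ennreal (b l * K ^ Suc l) * energy t u (j + l)) + ennreal e"
    by (simp add: add_mono add.commute)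
qed

end

section \<open>Integrals and series with values in [0, infinity]\<close>

text \<open>The constant is pulled out of the integral of \<open>P\<close>, so measurability is
  asked of \<open>P\<close> alone. This suits the double integral, whose kernel contains the mass of
  a ball with varying radius.\<close>

lemma nn_integral_le_cmult:
  assumes "P \<in> borel_measurable M" "0 < C" "\<And>x. P x \<le> ennreal C * F x"
  shows "(\<integral>\<^sup>+x. P x \<partial>M) \<le> ennreal C * (\<integral>\<^sup>+x. F x \<partial>M)"
proof -
  have inv: "ennreal C * ennreal (1 / C) = 1" "ennreal (1 / C) * ennreal C = 1"
    using assms(2) by (simp_all add: ennreal_mult[symmetric])
  have "(\<integral>\<^sup>+x. P x \<partial>M) = ennreal C * (\<integral>\<^sup>+x. ennreal (1 / C) * P x \<partial>M)"
    using assms(1) by (simp add: nn_integral_cmult mult.assoc[symmetric] inv)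
  also have "\<dots> \<le> ennreal C * (\<integral>\<^sup>+x. F x \<partial>M)"
  proof (intro mult_left_mono nn_integral_mono)
    fix x
    have "ennreal (1 / C) * P x \<le> ennreal (1 / C) * (ennreal C * F x)"
      by (intro mult_left_mono assms) auto
    then show "ennreal (1 / C) * P x \<le> F x" by (simp add: mult.assoc[symmetric] inv)
  qed auto
  finally show ?thesis .
qed

lemma suminf_ennreal_swap:
  fixes f :: "nat \<Rightarrow> nat \<Rightarrow> ennreal"
  shows "(\<Sum>k. \<Sum>l. f k l) = (\<Sum>l. \<Sum>k. f k l)"
  using nn_integral_suminf[of "\<lambda>l k. f k l" "count_space UNIV"]
  by (simp add: nn_integral_count_space_nat)

lemma suminf_ennreal_convolution_le:
  fixes c e :: "nat \<Rightarrow> ennreal"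
  shows "(\<Sum>k. \<Sum>l. c l * e (k + l)) \<le> (\<Sum>l. c l) * (\<Sum>k. e k)"
proof -
  have shift: "(\<Sum>k. e (k + l)) \<le> (\<Sum>k. e k)" for l
  proof (subst suminf_eq_SUP, rule SUP_least)
    fix n
    have "(\<Sum>k<n. e (k + l)) = sum e ((\<lambda>k. k + l) ` {..<n})"
      by (simp add: sum.reindex inj_on_def)
    also have "\<dots> \<le> (\<Sum>k. e k)" by (intro sum_le_suminf) auto
    finally show "(\<Sum>k<n. e (k + l)) \<le> (\<Sum>k. e k)" .
  qed
  have "(\<Sum>k. \<Sum>l. c l * e (k + l)) = (\<Sum>l. c l * (\<Sum>k. e (k + l)))"
    by (subst suminf_ennreal_swap) simp
  also have "\<dots> \<le> (\<Sum>l. c l * (\<Sum>k. e k))"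
    by (intro suminf_le mult_left_mono shift) auto
  finally show ?thesis by simp
qed

lemma ennreal_le_suminf_term: "f k \<le> (\<Sum>k. f k)" for f :: "nat \<Rightarrow> ennreal"
  using sum_le_suminf[of f "{k}"] by simp

section \<open>Summing the energies of all scales\<close>

context thick_nets
begin

text \<open>cD^6 combines the overlap cD^4 with a mass comparison cD^2; the other factor is the sum
  of the geometric series of scales.\<close>

definition "kernel_const p = cD ^ 6 * 5 powr p / (1 - lam powr p)"

lemma lam_powr_less_1: "0 < p \<Longrightarrow> lam powr p < 1"
  using powr_less_mono2[of p lam 1] lam_pos lam_le by simp

lemma kernel_const_pos: "0 < p \<Longrightarrow> 0 < kernel_const p"
  unfolding kernel_const_def using lam_powr_less_1[of p] cD_ge_1 by (intro divide_pos_pos mult_pos_pos) auto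

lemma rho_powr_Suc: "\<rho> j powr - p = lam powr p * \<rho> (Suc j) powr - p"
  using rho_pos[of j] lam_pos by (simp add: rho_Suc powr_mult powr_minus field_simps)

lemma rho_powr_add: "\<rho> j powr - p = (lam powr p) ^ l * \<rho> (j + l) powr - p"
proof (induction l)
  case (Suc l)
  then show ?case using rho_powr_Suc[of "j + l" p] by simp
qed simp

text \<open>A geometric series dominated by its last term, which belongs to the smallest scale above
  d/5.\<close>

lemma sum_rho_powr_le:
  assumes "0 < d" "0 < p"
  shows "(\<Sum>j<n. if d < 5 * \<rho> j then \<rho> j powr - p else 0) \<le> 5 powr p / (1 - lam powr p) * d powr - p"
proof -
  define R where "R = lam powr p"
  have R: "0 < R" "R < 1" using lam_powr_less_1[of p] lam_pos assms by (auto simp: R_def)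
  let ?S = "\<Sum>j<n. if d < 5 * \<rho> j then \<rho> j powr - p else 0"
  \<comment> \<open>The second bound makes the induction close without naming the last scale: adding
    a new term to it gives R rho_n^-p + (1 - R) rho_n^-p = rho_n^-p.\<close>
  have "(1 - R) * ?S \<le> 5 powr p * d powr - p \<and> (1 - R) * ?S \<le> R * \<rho> n powr - p"
  proof (induction n)
    case 0
    then show ?case using R by simp
  next
    case (Suc n)
    have Sn: "\<rho> n powr - p = R * \<rho> (Suc n) powr - p" unfolding R_def by (rule rho_powr_Suc)
    show ?case
    proof (cases "d < 5 * \<rho> n")
      case True
      have "(1 - R) * ((\<Sum>j<n. if d < 5 * \<rho> j then \<rho> j powr - p else 0) + \<rho> n powr - p)
          \<le> R * \<rho> n powr - p + (1 - R) * \<rho> n powr - p"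
        using Suc by (simp add: distrib_left)
      also have "\<dots> = \<rho> n powr - p" by (simp add: algebra_simps)
      finally have le: "(1 - R) * (\<Sum>j<Suc n. if d < 5 * \<rho> j then \<rho> j powr - p else 0) \<le> \<rho> n powr - p"
        using True by simp
      have "\<rho> n powr - p \<le> (d / 5) powr - p"
        using True assms rho_pos[of n] by (intro powr_mono2') auto
      also have "\<dots> = 5 powr p * d powr - p"
        using assms by (simp add: powr_divide powr_minus field_simps)
      finally show ?thesis using le Sn by simp
    next
      case False
      have "R * \<rho> n powr - p \<le> \<rho> n powr - p" using R by (simp add: mult_left_le_one_le)
      then show ?thesis using Suc False Sn by simp
    qed
  qed
  then show ?thesis using R by (simp add: R_def field_simps)
qed

lemma kernel_sum_le:
  assumes "x \<noteq> y" "0 < p"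
  shows "(\<Sum>j<n. \<Sum>z\<in>N j. \<rho> j powr - p / cell_mass j z * (indicator (net_cell j z) x * indicator (ball z (3 * \<rho> j)) y))
    \<le> kernel_const p / (dist x y powr p * measure M (ball x (dist x y)))"
proof -
  let ?d = "dist x y" and ?\<mu> = "measure M (ball x (dist x y))"
  have d: "0 < ?d" using assms by simp
  have \<mu>: "0 < ?\<mu>" using d by (rule measure_ball_pos)
  have level: "(\<Sum>z\<in>N j. \<rho> j powr - p / cell_mass j z * (indicator (net_cell j z) x * indicator (ball z (3 * \<rho> j)) y))
      \<le> cD ^ 6 / ?\<mu> * (if ?d < 5 * \<rho> j then \<rho> j powr - p else 0)" for j
  proof -
    let ?k = "if ?d < 5 * \<rho> j then cD ^ 2 / ?\<mu> * \<rho> j powr - p else 0"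
    have k: "0 \<le> ?k" using \<mu> cD_ge_1 by auto
    have "(\<Sum>z\<in>N j. \<rho> j powr - p / cell_mass j z * (indicator (net_cell j z) x * indicator (ball z (3 * \<rho> j)) y))
        \<le> (\<Sum>z\<in>N j. indicator (net_cell j z) x * ?k)"
    proof (rule sum_mono)
      fix z
      show "\<rho> j powr - p / cell_mass j z * (indicator (net_cell j z) x * indicator (ball z (3 * \<rho> j)) y)
          \<le> indicator (net_cell j z) x * ?k"
      proof (cases "x \<in> net_cell j z \<and> y \<in> ball z (3 * \<rho> j)")
        case True
        then have d5: "?d < 5 * \<rho> j"
          using dist_triangle[of x y z] by (simp add: dist_commute)
        \<comment> \<open>The ball around x of radius d(x,y) reaches at most 2 rho_j + 5 rho_j from
          z, within four times the cell radius: two doublings.\<close>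
        have "?\<mu> \<le> cD ^ 2 * cell_mass j z"
          using True d5 d rho_pos[of j] by (intro measure_ball_le) (auto simp: dist_commute)
        then have "1 / cell_mass j z \<le> cD ^ 2 / ?\<mu>"
          using \<mu> cell_mass_pos[of z j] by (simp add: field_simps)
        then have "\<rho> j powr - p * (1 / cell_mass j z) \<le> \<rho> j powr - p * (cD ^ 2 / ?\<mu>)"
          by (intro mult_left_mono) auto
        then show ?thesis using True d5 by (simp add: mult_ac)
      next
        case False
        then show ?thesis using k by (auto simp: indicator_def)
      qed
    qed
    also have "\<dots> = (\<Sum>z\<in>N j. indicator (net_cell j z) x) * ?k"
      by (simp only: sum_distrib_right)
    also have "(\<Sum>z\<in>N j. indicator (net_cell j z) x :: real) = real (card {z \<in> N j. x \<in> net_cell j z})"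
      using net_finite[of j] by (simp add: indicator_def of_bool_def sum.If_cases Int_def)
    also have "\<dots> * ?k \<le> cD ^ 4 * ?k"
      using card_net_overlap k by (rule mult_right_mono)
    finally show ?thesis by (simp add: power_numeral_reduce mult_ac split: if_splits)
  qed
  have "(\<Sum>j<n. \<Sum>z\<in>N j. \<rho> j powr - p / cell_mass j z * (indicator (net_cell j z) x * indicator (ball z (3 * \<rho> j)) y))
      \<le> cD ^ 6 / ?\<mu> * (\<Sum>j<n. if ?d < 5 * \<rho> j then \<rho> j powr - p else 0)"
    unfolding sum_distrib_left by (intro sum_mono level)
  also have "\<dots> \<le> cD ^ 6 / ?\<mu> * (5 powr p / (1 - lam powr p) * ?d powr - p)"
    using \<mu> cD_ge_1 d assms by (intro mult_left_mono sum_rho_powr_le) auto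
  also have "\<dots> = kernel_const p / (?d powr p * ?\<mu>)"
    by (simp add: kernel_const_def powr_minus field_simps)
  finally show ?thesis .
qed

text \<open>For each partial sum, the finite sums are moved inside both integrals and the kernel is
  bounded pointwise by \<open>kernel_sum_le\<close>.\<close>

lemma suminf_energy_le:
  assumes u: "continuous_on UNIV u" and t: "0 < t" and p: "0 < p"
  shows "(\<Sum>j. ennreal (\<rho> j powr - p) * energy t u j)
    \<le> ennreal (kernel_const p) * (\<integral>\<^sup>+x\<in>ball w (3 * r). (\<integral>\<^sup>+y\<in>ball w (3 * r).
        ennreal (\<bar>u x - u y\<bar> powr t / (dist x y powr p * measure M (ball x (dist x y)))) \<partial>M) \<partial>M)"
proof (subst suminf_eq_SUP, rule SUP_least)
  fix n
  let ?S = "\<lambda>j z. ball z (3 * \<rho> j)" and ?B = "ball w (3 * r)"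
  let ?c = "\<lambda>j z. \<rho> j powr - p / cell_mass j z"
  let ?D = "\<lambda>x y. ennreal (\<bar>u x - u y\<bar> powr t)"
  let ?H = "\<lambda>A x. \<integral>\<^sup>+y\<in>A. ?D x y \<partial>M"
  let ?k = "\<lambda>x y. ennreal (\<bar>u x - u y\<bar> powr t / (dist x y powr p * measure M (ball x (dist x y))))"
  let ?P = "\<lambda>x. \<Sum>j<n. \<Sum>z\<in>N j. ennreal (?c j z) * (?H (?S j z) x * indicator (net_cell j z) x)"
  have c: "0 \<le> ?c j z" for j z by simp
  have sub: "?S j z \<subseteq> ?B" if "z \<in> N j" for j z
    using net_ball[OF that] by (intro ball_subset_ball_dist) (simp add: dist_commute)
  note [measurable] = measurable_pow(2)[OF u]
  have [measurable]: "?H (?S j z) \<in> borel_measurable M" for j z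
    by (intro measurable_inner_oscillation[OF u t]) simp
  have [measurable]: "ball z R \<in> sets M" for z :: 'a and R by simp
  have "(\<Sum>j<n. ennreal (\<rho> j powr - p) * energy t u j)
      = (\<Sum>j<n. \<Sum>z\<in>N j. ennreal (?c j z) * oscillation t u (net_cell j z) (?S j z))"
    unfolding energy_def sum_distrib_left
    by (intro sum.cong refl) (simp add: mult.assoc[symmetric] ennreal_mult[symmetric])
  also have "\<dots> = (\<integral>\<^sup>+x. ?P x \<partial>M)"
    unfolding oscillation_def by (simp add: nn_integral_sum nn_integral_cmult)
  also have "\<dots> \<le> ennreal (kernel_const p) * (\<integral>\<^sup>+x. (\<integral>\<^sup>+y\<in>?B. ?k x y \<partial>M) * indicator ?B x \<partial>M)"
  proof (rule nn_integral_le_cmult)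
    show "?P \<in> borel_measurable M" by measurable
    show "0 < kernel_const p" using p by (rule kernel_const_pos)
    fix x
    show "?P x \<le> ennreal (kernel_const p) * ((\<integral>\<^sup>+y\<in>?B. ?k x y \<partial>M) * indicator ?B x)"
    proof (cases "x \<in> ?B")
      case False
      then have "x \<notin> net_cell j z" if "z \<in> N j" for j z
        using net_cell_subset[OF that] by auto
      then have "?P x = 0" by (simp add: indicator_def)
      then show ?thesis by simp
    next
      case True
      let ?G = "\<lambda>y. \<Sum>j<n. \<Sum>z\<in>N j. (ennreal (?c j z) * indicator (net_cell j z) x) * (?D x y * indicator (?S j z) y)"
      have summand: "ennreal (?c j z) * (?H (?S j z) x * indicator (net_cell j z) x)
          = (\<integral>\<^sup>+y. (ennreal (?c j z) * indicator (net_cell j z) x) * (?D x y * indicator (?S j z) y) \<partial>M)" for j z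
        by (subst nn_integral_cmult, measurable) (simp only: mult_ac)
      have "?P x = (\<integral>\<^sup>+y. ?G y \<partial>M)"
        unfolding summand by (simp add: nn_integral_sum)
      also have "\<dots> \<le> ennreal (kernel_const p) * (\<integral>\<^sup>+y\<in>?B. ?k x y \<partial>M)"
      proof (rule nn_integral_le_cmult)
        show "?G \<in> borel_measurable M" by measurable
        show "0 < kernel_const p" using p by (rule kernel_const_pos)
        fix y
        show "?G y \<le> ennreal (kernel_const p) * (?k x y * indicator ?B y)"
        \<comment> \<open>On the diagonal the difference of u vanishes, and outside 3B every
          indicator does.\<close>
        proof (cases "x \<noteq> y \<and> y \<in> ?B")
          case False
          then have zero: "?D x y * indicator (?S j z) y = 0" if "z \<in> N j" for j z
            using sub[OF that] by (cases "x = y") (auto simp: indicator_def subset_iff)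
          have "?G y = 0" by (simp add: zero cong: sum.cong)
          then show ?thesis by simp
        next
          case True
          have summand': "(ennreal (?c j z) * indicator (net_cell j z) x) * (?D x y * indicator (?S j z) y)
              = ?D x y * ennreal (?c j z * (indicator (net_cell j z) x * indicator (?S j z) y))" for j z
            by (simp add: indicator_def mult.commute)
          have "?G y = ?D x y * ennreal (\<Sum>j<n. \<Sum>z\<in>N j. ?c j z * (indicator (net_cell j z) x * indicator (?S j z) y))"
            unfolding summand' using c
            by (simp add: sum_distrib_left[symmetric] sum_ennreal sum_nonneg)
          also have "\<dots> \<le> ?D x y * ennreal (kernel_const p / (dist x y powr p * measure M (ball x (dist x y))))"
            using True p by (intro mult_left_mono ennreal_leI kernel_sum_le) auto
          also have "\<dots> = ennreal (kernel_const p) * (?k x y * indicator ?B y)"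
            using True kernel_const_pos[OF p] by (simp add: ennreal_mult[symmetric])
          finally show ?thesis .
        qed
      qed
      finally show ?thesis using True by simp
    qed
  qed
  finally show "(\<Sum>j<n. ennreal (\<rho> j powr - p) * energy t u j)
    \<le> ennreal (kernel_const p) * (\<integral>\<^sup>+x\<in>?B. (\<integral>\<^sup>+y\<in>?B. ?k x y \<partial>M) \<partial>M)" .
qed

end

section \<open>Geometric weights along the chains\<close>

text \<open>The weights 1 + 2^-i fall from 2 towards 1, and the increment of step i receives the
  difference 2^-(i+1). The coefficient of |u|^t thus stays between 2^(1-t) and 1, at the price of a
  factor growing like 2^((t-1)(i+1)) on the increments.\<close>

lemma powr_add_dyadic:
  fixes x y t :: real
  assumes "1 \<le> t" "0 \<le> x" "0 \<le> y"
  shows "(1 + (1 / 2) ^ i) powr (1 - t) * (x + y) powr t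
    \<le> (1 + (1 / 2) ^ Suc i) powr (1 - t) * x powr t + (2 powr (t - 1)) ^ Suc i * y powr t"
proof -
  have split: "1 + (1 / 2) ^ i = (1 + (1 / 2) ^ Suc i) + (1 / 2 :: real) ^ Suc i" by simp
  have half: "(1 / 2 :: real) ^ n = 2 powr - real n" for n
    by (simp add: powr_minus powr_realpow power_one_over inverse_eq_divide)
  have "((1 / 2 :: real) ^ Suc i) powr (1 - t) = (2 powr (t - 1)) powr real (Suc i)"
    unfolding half powr_powr by (rule arg_cong[where f = "\<lambda>a. 2 powr a"]) (simp add: algebra_simps)
  then have "((1 / 2 :: real) ^ Suc i) powr (1 - t) = (2 powr (t - 1)) ^ Suc i"
    by (subst (asm) powr_realpow) simp_all
  then show ?thesis
    unfolding split using powr_add_weighted[OF assms(1) _ _ assms(2,3), of "1 + (1 / 2) ^ Suc i" "(1 / 2) ^ Suc i"]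
    by (simp add: add_pos_pos)
qed

context thick_nets
begin

lemma sum_pow_integral_le_geometric:
  assumes u: "continuous_on UNIV u" "\<And>x. x \<in> E \<Longrightarrow> u x = 0" and t: "1 < t"
  shows "(\<Sum>z\<in>N j. pow_integral t u (net_cell j z))
    \<le> ennreal (2 powr (t - 1)) * (\<Sum>l. ennreal ((2 powr (t - 1) * K) ^ Suc l) * energy t u (j + l))"
proof -
  let ?a = "\<lambda>i::nat. (1 + (1 / 2) ^ i) powr (1 - t) :: real"
  let ?\<beta> = "2 powr (t - 1)"
  \<comment> \<open>The initial weight is 2, so the initial coefficient is 2^(1-t) and is removed by
    multiplication with 2^(t-1).\<close>
  have inv: "ennreal ?\<beta> * ennreal (?a 0) = 1"
    by (simp add: ennreal_mult[symmetric] powr_add[symmetric])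
  have le1: "?a i \<le> 1" for i
  proof -
    have "?a i \<le> 1 powr (1 - t)" using t by (intro powr_mono2') auto
    then show ?thesis by simp
  qed
  have "ennreal (?a 0) * (\<Sum>z\<in>N j. pow_integral t u (net_cell j z))
      \<le> (\<Sum>l. ennreal (?\<beta> ^ Suc l * K ^ Suc l) * energy t u (j + l))"
    using t le1 powr_add_dyadic[of t]
    by (intro sum_pow_integral_le_energy[where a = ?a and b = "\<lambda>i. ?\<beta> ^ Suc i", OF u]) auto
  then have "ennreal ?\<beta> * (ennreal (?a 0) * (\<Sum>z\<in>N j. pow_integral t u (net_cell j z)))
      \<le> ennreal ?\<beta> * (\<Sum>l. ennreal (?\<beta> ^ Suc l * K ^ Suc l) * energy t u (j + l))"
    by (intro mult_left_mono) auto
  moreover have "ennreal ?\<beta> * (ennreal (?a 0) * S) = S" for S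
    by (simp only: mult.assoc[symmetric] inv mult_1)
  ultimately show ?thesis by (simp only: power_mult_distrib)
qed

text \<open>Moving the weight from level j to level j + l gains lam^(p l), which by
  \<open>small\<close> beats the growth of the chain and leaves (1/2)^l. The double series is then a
  convolution, and the geometric sum is the leading 2 of the constant.\<close>

lemma suminf_pow_integral_le_energy:
  assumes u: "continuous_on UNIV u" "\<And>x. x \<in> E \<Longrightarrow> u x = 0" and t: "1 < t"
    and small: "2 powr (t - 1) * K * lam powr p \<le> 1 / 2"
  shows "(\<Sum>j. ennreal (\<rho> j powr - p) * (\<Sum>z\<in>N j. pow_integral t u (net_cell j z)))
    \<le> ennreal (2 * (2 powr (t - 1) * (2 powr (t - 1) * K))) * (\<Sum>j. ennreal (\<rho> j powr - p) * energy t u j)"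
proof -
  let ?\<beta> = "2 powr (t - 1)"
  let ?e = "\<lambda>j. ennreal (\<rho> j powr - p) * energy t u j"
  let ?c = "\<lambda>l. ennreal (?\<beta> * (?\<beta> * K) * (1 / 2) ^ l)"
  have le: "ennreal (\<rho> j powr - p) * (\<Sum>z\<in>N j. pow_integral t u (net_cell j z))
      \<le> (\<Sum>l. ?c l * ?e (j + l))" for j
  proof -
    have "ennreal (\<rho> j powr - p) * (\<Sum>z\<in>N j. pow_integral t u (net_cell j z))
      \<le> ennreal (\<rho> j powr - p) * (ennreal ?\<beta> * (\<Sum>l. ennreal ((?\<beta> * K) ^ Suc l) * energy t u (j + l)))"
      by (intro mult_left_mono sum_pow_integral_le_geometric[OF u t]) auto
    also have "\<dots> = (\<Sum>l. ennreal (\<rho> j powr - p * ?\<beta> * (?\<beta> * K) ^ Suc l) * energy t u (j + l))"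
      using K_pos unfolding ennreal_suminf_cmult[symmetric]
      by (intro suminf_cong) (simp add: ennreal_mult mult_ac)
    also have "\<dots> \<le> (\<Sum>l. ?c l * ?e (j + l))"
    proof (intro suminf_le)
      fix l
      have "(?\<beta> * K * lam powr p) ^ l \<le> (1 / 2) ^ l"
        using K_pos by (intro power_mono small) auto
      then have "?\<beta> * (?\<beta> * K) * \<rho> (j + l) powr - p * (?\<beta> * K * lam powr p) ^ l
          \<le> ?\<beta> * (?\<beta> * K) * \<rho> (j + l) powr - p * (1 / 2) ^ l"
        using K_pos by (intro mult_left_mono) auto
      then have "\<rho> j powr - p * ?\<beta> * (?\<beta> * K) ^ Suc l \<le> ?\<beta> * (?\<beta> * K) * (1 / 2) ^ l * \<rho> (j + l) powr - p"
        unfolding rho_powr_add[of j p l] by (simp add: power_mult_distrib mult_ac)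
      then have "ennreal (\<rho> j powr - p * ?\<beta> * (?\<beta> * K) ^ Suc l)
          \<le> ?c l * ennreal (\<rho> (j + l) powr - p)"
        using K_pos by (subst ennreal_mult[symmetric]) (auto intro!: ennreal_leI)
      then show "ennreal (\<rho> j powr - p * ?\<beta> * (?\<beta> * K) ^ Suc l) * energy t u (j + l) \<le> ?c l * ?e (j + l)"
        by (simp add: mult.assoc[symmetric] mult_right_mono)
    qed auto
    finally show ?thesis .
  qed
  have "(\<Sum>j. ennreal (\<rho> j powr - p) * (\<Sum>z\<in>N j. pow_integral t u (net_cell j z)))
      \<le> (\<Sum>j. \<Sum>l. ?c l * ?e (j + l))"
    by (intro suminf_le le) auto
  also have "\<dots> \<le> (\<Sum>l. ?c l) * (\<Sum>j. ?e j)"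
    by (rule suminf_ennreal_convolution_le)
  also have "(\<lambda>l. ?\<beta> * (?\<beta> * K) * (1 / 2) ^ l) sums (?\<beta> * (?\<beta> * K) * 2)"
    using geometric_sums[of "1 / 2 :: real"] by (intro sums_mult) simp
  then have "(\<Sum>l. ?c l) = ennreal (?\<beta> * (?\<beta> * K) * 2)"
    using K_pos by (intro sums_unique[symmetric] sums_ennreal[THEN iffD2]) auto
  finally show ?thesis by (simp add: mult_ac)
qed

section \<open>Layers around E and the Hardy inequality\<close>

lemma layer_exists:
  assumes "closed E" "x \<notin> E" "dist w x < r" "w \<in> E"
  obtains k where "\<rho> (Suc k) \<le> infdist x E" "infdist x E < \<rho> k"
proof -
  have pos: "0 < infdist x E"
    using assms in_closed_iff_infdist_zero[of E x] infdist_nonneg[of x E] by fastforce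
  have r: "infdist x E < r" using infdist_le[OF assms(4), of x] assms(3) by (simp add: dist_commute)
  have "\<rho> \<longlonglongrightarrow> 0 * r"
    unfolding rho[abs_def] using lam_pos lam_le by (intro tendsto_intros LIMSEQ_power_zero) auto
  then have "\<forall>\<^sub>F j in sequentially. \<rho> j < infdist x E"
    using pos by (intro order_tendstoD) auto
  then obtain n where "\<rho> n < infdist x E" by (auto simp: eventually_sequentially)
  then have ex: "\<exists>k. \<rho> k \<le> infdist x E" by (auto intro: less_imp_le)
  define m where "m = (LEAST k. \<rho> k \<le> infdist x E)"
  have m: "\<rho> m \<le> infdist x E" unfolding m_def using ex by (rule LeastI_ex)
  \<comment> \<open>The distance to E is below r = rho_0 because w lies in E, so the least index has
    a predecessor.\<close>
  have "m \<noteq> 0" using m r by (cases m) (auto simp: rho)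
  then obtain k where k: "m = Suc k" using not0_implies_Suc by blast
  then have "\<not> \<rho> k \<le> infdist x E" unfolding m_def by (intro not_less_Least) auto
  then show ?thesis using that[of k] m k by auto
qed

text \<open>Where the distance to E lies between rho_(k+1) and rho_k, the weight is at most
  rho_(k+1)^-p = lam^-p rho_k^-p, and the cells of level k cover that layer within B.\<close>

lemma hardy_integral_le_layers:
  assumes u: "continuous_on UNIV u" and E: "closed E" "w \<in> E" and p: "0 < p"
  shows "(\<integral>\<^sup>+x\<in>ball w r - E. ennreal (\<bar>u x\<bar> powr t / infdist x E powr p) \<partial>M)
    \<le> ennreal (lam powr - p) * (\<Sum>j. ennreal (\<rho> j powr - p) * (\<Sum>z\<in>N j. pow_integral t u (net_cell j z)))"
proof -
  let ?U = "\<lambda>x. ennreal (\<bar>u x\<bar> powr t)"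
  let ?L = "\<lambda>x k. ennreal (\<rho> (Suc k) powr - p) * (\<Sum>z\<in>N k. ?U x * indicator (net_cell k z) x)"
  note [measurable] = measurable_pow(1)[OF u]
  have [measurable]: "ball z R \<in> sets M" for z :: 'a and R by simp
  have "(\<integral>\<^sup>+x\<in>ball w r - E. ennreal (\<bar>u x\<bar> powr t / infdist x E powr p) \<partial>M)
      \<le> (\<integral>\<^sup>+x. (\<Sum>k. ?L x k) \<partial>M)"
  proof (rule nn_integral_mono)
    fix x
    show "ennreal (\<bar>u x\<bar> powr t / infdist x E powr p) * indicator (ball w r - E) x \<le> (\<Sum>k. ?L x k)"
    proof (cases "x \<in> ball w r - E")
      case True
      then obtain k where k: "\<rho> (Suc k) \<le> infdist x E" "infdist x E < \<rho> k"
        using layer_exists[OF E(1) _ _ E(2), of x] by auto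
      obtain z where z: "z \<in> N k" "dist x z < 2 * \<rho> k"
        using net_cover[of x k] k True by auto
      have "infdist x E powr - p \<le> \<rho> (Suc k) powr - p"
        using k rho_pos[of "Suc k"] p by (intro powr_mono2') auto
      then have "infdist x E powr - p * \<bar>u x\<bar> powr t \<le> \<rho> (Suc k) powr - p * \<bar>u x\<bar> powr t"
        by (rule mult_right_mono) simp
      then have "ennreal (\<bar>u x\<bar> powr t / infdist x E powr p) \<le> ennreal (\<rho> (Suc k) powr - p) * ?U x"
        by (subst ennreal_mult[symmetric]) (auto simp: powr_minus_divide intro!: ennreal_leI)
      also have "?U x \<le> (\<Sum>z\<in>N k. ?U x * indicator (net_cell k z) x)"
        using z net_finite[of k] member_le_sum[of z "N k" "\<lambda>z. ?U x * indicator (net_cell k z) x"]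
        by (simp add: dist_commute)
      also have "ennreal (\<rho> (Suc k) powr - p) * \<dots> \<le> (\<Sum>k. ?L x k)"
        by (rule ennreal_le_suminf_term)
      finally show ?thesis using True by (simp add: mult_left_mono)
    qed simp
  qed
  also have "\<dots> = (\<Sum>k. ennreal (\<rho> (Suc k) powr - p) * (\<Sum>z\<in>N k. pow_integral t u (net_cell k z)))"
    unfolding pow_integral_def
    by (subst nn_integral_suminf, measurable) (simp add: nn_integral_cmult nn_integral_sum)
  also have "\<dots> = (\<Sum>k. ennreal (lam powr - p) * (ennreal (\<rho> k powr - p) * (\<Sum>z\<in>N k. pow_integral t u (net_cell k z))))"
    using lam_pos rho_pos by (simp add: rho_Suc powr_mult ennreal_mult mult.assoc less_imp_le)
  finally show ?thesis by simp
qed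

lemma hardy_inequality:
  assumes u: "continuous_on UNIV u" "\<And>x. x \<in> E \<Longrightarrow> u x = 0" and E: "closed E" "w \<in> E"
    and t: "1 < t" and p: "0 < p" and small: "2 powr (t - 1) * K * lam powr p \<le> 1 / 2"
  shows "(\<integral>\<^sup>+x\<in>ball w r - E. ennreal (\<bar>u x\<bar> powr t / infdist x E powr p) \<partial>M)
    \<le> ennreal (lam powr - p * (2 * (2 powr (t - 1) * (2 powr (t - 1) * K))) * kernel_const p)
      * (\<integral>\<^sup>+x\<in>ball w (3 * r). (\<integral>\<^sup>+y\<in>ball w (3 * r).
        ennreal (\<bar>u x - u y\<bar> powr t / (dist x y powr p * measure M (ball x (dist x y)))) \<partial>M) \<partial>M)"
    (is "?lhs \<le> ennreal (?A * ?B * ?C) * ?rhs")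
proof -
  have "?lhs \<le> ennreal ?A * (\<Sum>j. ennreal (\<rho> j powr - p) * (\<Sum>z\<in>N j. pow_integral t u (net_cell j z)))"
    by (rule hardy_integral_le_layers[OF u(1) E p])
  also have "\<dots> \<le> ennreal ?A * (ennreal ?B * (\<Sum>j. ennreal (\<rho> j powr - p) * energy t u j))"
    by (intro mult_left_mono suminf_pow_integral_le_energy[OF u t small]) auto
  also have "\<dots> \<le> ennreal ?A * (ennreal ?B * (ennreal ?C * ?rhs))"
    using t by (intro mult_left_mono suminf_energy_le[OF u(1) _ p]) auto
  also have "\<dots> = ennreal (?A * ?B * ?C) * ?rhs"
    using K_pos kernel_const_pos[OF p] by (simp add: ennreal_mult mult.assoc)
  finally show ?thesis .
qed

end

section \<open>Construction of the nets\<close>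

lemma (in doubling_space) nets_exist:
  fixes E :: "'a set"
  assumes w: "w \<in> E" and r: "0 < r" and lam: "0 < lam" "lam \<le> 1 / 8"
    and rho: "\<And>j. \<rho> j = lam ^ j * r"
  obtains N where "\<And>j. finite (N j)" "\<And>j. N j \<subseteq> E" "\<And>j. separated (\<rho> j) (N j)"
    "\<And>j z. z \<in> N j \<Longrightarrow> dist w z + 3 * \<rho> j \<le> 3 * r"
    "\<And>j z e. z \<in> N j \<Longrightarrow> e \<in> E \<Longrightarrow> dist z e < \<rho> j + \<rho> (Suc j) \<Longrightarrow> \<exists>z'\<in>N (Suc j). dist e z' < \<rho> (Suc j)"
    "\<And>j x. dist w x < r \<Longrightarrow> infdist x E < \<rho> j \<Longrightarrow> \<exists>z\<in>N j. dist x z < 2 * \<rho> j"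
proof -
  have rho_pos: "0 < \<rho> j" for j using lam r by (simp add: rho)
  have rho_Suc: "8 * \<rho> (Suc j) \<le> \<rho> j" for j
    using mult_right_mono[OF lam(2), of "\<rho> j"] rho_pos[of j] by (simp add: rho)
  have rho_le: "8 * \<rho> (Suc j) \<le> r" for j
    using rho_Suc[of j] mult_right_mono[of "lam ^ j" 1 r] power_le_one[of lam j] lam r
    unfolding rho by linarith
  \<comment> \<open>The radius grows with j to leave room for descending: 2r - 4 rho_j + rho_j +
    rho_(j+1) <= 2r - 4 rho_(j+1), since 8 rho_(j+1) <= rho_j. It stays below 2r, which keeps the
    enlarged cells inside 3B.\<close>
  let ?A = "\<lambda>j. E \<inter> ball w (2 * r - 4 * \<rho> j)"
  define good where "good j F \<longleftrightarrow> finite F \<and> F \<subseteq> ?A j \<and> separated (\<rho> j) F \<and>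
    (\<forall>a\<in>?A j. \<exists>z\<in>F. dist a z < \<rho> j)" for j F
  have "\<exists>F. good j F" for j
    using maximal_separated_exists[of "?A j" w "2 * r - 4 * \<rho> j" "\<rho> j"] rho_pos[of j] unfolding good_def
    by (metis Int_lower2)
  then obtain F where F: "\<And>j. good j (F j)" by metis
  \<comment> \<open>At level 0 the radius 2r - 4 rho_0 is negative, so the centre w alone serves as
    the net.\<close>
  define N where "N j = (if j = 0 then {w} else F j)" for j
  have covers: "\<exists>z\<in>N (Suc j). dist e z < \<rho> (Suc j)" if "e \<in> E" "dist w e < 2 * r - 4 * \<rho> (Suc j)" for e j
    using F[of "Suc j"] that unfolding good_def N_def by auto
  have sub: "dist w z < 2 * r - 4 * \<rho> (Suc j)" if "z \<in> N (Suc j)" for z j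
    using F[of "Suc j"] that unfolding good_def N_def by auto
  show ?thesis
  proof (rule that[of N])
    show "finite (N j)" "N j \<subseteq> E" "separated (\<rho> j) (N j)" for j
      using F[of j] w by (auto simp: N_def good_def separated_def)
    show "dist w z + 3 * \<rho> j \<le> 3 * r" if "z \<in> N j" for j z
    proof (cases j)
      case 0
      then show ?thesis using that by (simp add: N_def rho)
    next
      case (Suc i)
      then show ?thesis using sub[of z i] that rho_pos[of j] r by simp
    qed
    show "\<exists>z'\<in>N (Suc j). dist e z' < \<rho> (Suc j)"
      if z: "z \<in> N j" and e: "e \<in> E" "dist z e < \<rho> j + \<rho> (Suc j)" for j z e
    proof (rule covers[OF e(1)])
      show "dist w e < 2 * r - 4 * \<rho> (Suc j)"
      proof (cases j)
        case 0
        have "\<rho> 0 = r" "z = w" using z 0 by (simp_all add: N_def rho)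
        then show ?thesis using e(2) rho_le[of 0] r unfolding 0 \<open>z = w\<close> by linarith
      next
        case (Suc i)
        then show ?thesis
          using sub[of z i] z e(2) dist_triangle[of w e z] rho_Suc[of j] rho_pos[of "Suc j"] by simp
      qed
    qed
    show "\<exists>z\<in>N j. dist x z < 2 * \<rho> j" if x: "dist w x < r" "infdist x E < \<rho> j" for j x
    proof (cases j)
      case 0
      then show ?thesis using x r by (simp add: N_def rho dist_commute)
    next
      case (Suc i)
      obtain e where e: "e \<in> E" "dist x e < \<rho> j"
        using x(2) w by (auto simp: infdist_def cINF_less_iff split: if_splits)
      have "dist w e < 2 * r - 4 * \<rho> (Suc i)"
        using dist_triangle[of w e x] e(2) x(1) rho_le[of i] rho_pos[of j] Suc by simp
      then obtain z where "z \<in> N j" "dist e z < \<rho> j" using covers[OF e(1)] Suc by auto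
      then show ?thesis using dist_triangle[of x z e] e(2) by (intro bexI[of _ z]) auto
    qed
  qed
qed

section \<open>Choice of the constants\<close>

theorem theorem5p2:
  fixes M :: "'a::complete_space measure"
    and s t :: real
    and E :: "'a set"
  assumes "metric_measure_space M"
    and "doubling_measure M"
    and "reverse_doubling_measure M"
    and "0 < s" "s < 1" "1 < t"
    and "closed E"
    and "upper_Assouad_codim M E < ennreal (s * t)"
  shows "\<exists>C::real. 0 < C \<and>
    (\<forall>u :: 'a \<Rightarrow> real. continuous_on UNIV u \<and> (\<forall>x\<in>E. u x = 0) \<longrightarrow>
      (\<forall>w\<in>E. \<forall>r::real. 0 < r \<and> ennreal r < ediam E \<longrightarrow>
        (\<integral>\<^sup>+x \<in> ball w r - E. ennreal (\<bar>u x\<bar> powr t / infdist x E powr (s * t)) \<partial>M)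
        \<le> ennreal C *
          (\<integral>\<^sup>+x \<in> ball w (3 * r).
            (\<integral>\<^sup>+y \<in> ball w (3 * r).
              ennreal (\<bar>u x - u y\<bar> powr t
                 / (dist x y powr (s * t) * measure M (ball x (dist x y)))) \<partial>M) \<partial>M)))"
proof -
  interpret metric_measure_space M by fact
  define p where "p = s * t"
  have p: "0 < p" using assms by (simp add: p_def)
  obtain cD where cD: "1 \<le> cD"
    "\<And>x r. 0 < r \<Longrightarrow> emeasure M (ball x (2 * r)) \<le> ennreal cD * emeasure M (ball x r)"
    using assms(2) unfolding doubling_measure_def by blast
  have em: "emeasure M (ball x r) = ennreal (measure M (ball x r))" if "0 < r" for x r
    using ball_finite[OF that, of x] by (simp add: emeasure_eq_ennreal_measure)
  interpret doubling_space M cD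
  proof
    show "1 \<le> cD" by fact
    show "measure M (ball x (2 * r)) \<le> cD * measure M (ball x r)" if "0 < r" for x r
      using cD(2)[OF that, of x] that cD(1) by (simp add: em ennreal_mult[symmetric])
  qed
  \<comment> \<open>The codimension is an infimum strictly below p, so some admissible exponent is
    strictly below p as well.\<close>
  obtain Q c where Q: "0 \<le> Q" "Q < p" and c: "0 < c"
    "\<And>x r R. x \<in> E \<Longrightarrow> 0 < r \<Longrightarrow> r < R \<Longrightarrow> is_singleton E \<or> ennreal R < ediam E \<Longrightarrow>
      c * (r / R) powr Q \<le> measure M (open_nbhd E r \<inter> ball x R) / measure M (ball x R)"
    using assms(8) p unfolding upper_Assouad_codim_def Inf_less_iff p_def[symmetric] by (auto simp: ennreal_less_iff)
  define \<beta> where "\<beta> = 2 powr (t - 1)"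
  \<comment> \<open>Solves beta (cD^5 / c) theta = 1/2. As K lam^p = (cD^5 / c) lam^(p-Q), the
    smallness condition reduces to lam^(p-Q) <= theta, which is possible because Q < p.\<close>
  define \<theta> where "\<theta> = c / (2 * \<beta> * cD ^ 5)"
  have \<theta>: "0 < \<theta>" using c(1) cD(1) by (simp add: \<theta>_def \<beta>_def)
  define lam where "lam = min (1 / 8) (\<theta> powr (1 / (p - Q)))"
  have lam: "0 < lam" "lam \<le> 1 / 8" using \<theta> by (auto simp: lam_def)
  define K where "K = cD ^ 5 / (c * lam powr Q)"
  have "lam powr (p - Q) \<le> (\<theta> powr (1 / (p - Q))) powr (p - Q)"
    using lam Q by (intro powr_mono2) (auto simp: lam_def)
  also have "\<dots> = \<theta>" using \<theta> Q by (simp add: powr_powr)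
  finally have "lam powr p / lam powr Q \<le> \<theta>" by (simp add: powr_diff)
  then have "\<beta> * (cD ^ 5 / c) * (lam powr p / lam powr Q) \<le> \<beta> * (cD ^ 5 / c) * \<theta>"
    using c(1) cD(1) by (intro mult_left_mono) (auto simp: \<beta>_def)
  also have "\<dots> = 1 / 2" using c(1) cD(1) by (simp add: \<theta>_def \<beta>_def)
  finally have small: "\<beta> * K * lam powr p \<le> 1 / 2" by (simp add: K_def)
  \<comment> \<open>Fixed before u, w and r are introduced; the nets depend on w and r, but none of
    the constants does.\<close>
  define C where "C = lam powr - p * (2 * (\<beta> * (\<beta> * K))) * (cD ^ 6 * 5 powr p / (1 - lam powr p))"
  have "lam powr p < 1" using powr_less_mono2[of p lam 1] lam p by simp
  then have "0 < C"
    using lam cD(1) c(1) by (simp add: C_def K_def \<beta>_def)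
  show ?thesis
  proof (intro exI[of _ C] conjI allI impI ballI; (elim conjE)?)
    show "0 < C" by fact
    fix u :: "'a \<Rightarrow> real" and w r
    assume u: "continuous_on UNIV u" "\<forall>x\<in>E. u x = 0" and w: "w \<in> E" and r: "0 < r" "ennreal r < ediam E"
    obtain N where N: "\<And>j. finite (N j)" "\<And>j. N j \<subseteq> E" "\<And>j. separated (lam ^ j * r) (N j)"
      "\<And>j z. z \<in> N j \<Longrightarrow> dist w z + 3 * (lam ^ j * r) \<le> 3 * r"
      "\<And>j z e. z \<in> N j \<Longrightarrow> e \<in> E \<Longrightarrow> dist z e < lam ^ j * r + lam ^ Suc j * r \<Longrightarrow>
        \<exists>z'\<in>N (Suc j). dist e z' < lam ^ Suc j * r"
      "\<And>j x. dist w x < r \<Longrightarrow> infdist x E < lam ^ j * r \<Longrightarrow> \<exists>z\<in>N j. dist x z < 2 * (lam ^ j * r)"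
      by (rule nets_exist[OF w r(1) lam, of "\<lambda>j. lam ^ j * r"]) auto
    \<comment> \<open>For \<open>thick\<close>, radii R <= r inherit R < diam E from r, so the
      codimension bound applies to them.\<close>
    interpret nets: thick_nets M cD E c Q lam r w "\<lambda>j. lam ^ j * r" N
    proof
      fix x r' R assume x: "x \<in> E" "0 < r'" "r' < R" "R \<le> r"
      have "ennreal R < ediam E" using x r by (intro le_less_trans[OF _ r(2)] ennreal_leI)
      then have "c * (r' / R) powr Q \<le> measure M (open_nbhd E r' \<inter> ball x R) / measure M (ball x R)"
        using c(2) x by auto
      then show "c * (r' / R) powr Q * measure M (ball x R) \<le> measure M (open_nbhd E r' \<inter> ball x R)"
        using measure_ball_pos[of R x] x by (simp add: pos_le_divide_eq)
    qed (use N lam c(1) r(1) in auto)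
    have K: "nets.K = K" by (simp add: nets.K_def K_def)
    show "(\<integral>\<^sup>+x \<in> ball w r - E. ennreal (\<bar>u x\<bar> powr t / infdist x E powr (s * t)) \<partial>M)
        \<le> ennreal C *
          (\<integral>\<^sup>+x \<in> ball w (3 * r).
            (\<integral>\<^sup>+y \<in> ball w (3 * r).
              ennreal (\<bar>u x - u y\<bar> powr t
                 / (dist x y powr (s * t) * measure M (ball x (dist x y)))) \<partial>M) \<partial>M)"
      using nets.hardy_inequality[OF u(1) _ assms(7) w assms(6) p] u(2) small
      unfolding K p_def[symmetric] C_def \<beta>_def nets.kernel_const_def by simp
  qed
qed

end
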